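(* For every fixed dimension $n\geq2$ there exist real numbers $l(n),u(n),\widetilde{l}(n),\widetilde{u}(n)\in\mathbb{R}$ such that for every $n$-dimensional CCPSR manifold $\mathcal{H}$ one has $$l(n)\leq S_{\mathcal{H}}\leq u(n)\qquad\text{and}\qquad \widetilde{l}(n)\leq K_{\mathcal{H}}\leq\widetilde{u}(n),$$ where $S_{\mathcal{H}}$ denotes the scalar curvature of $(\mathcal{H},g_{\mathcal{H}})$ (the inequality holding at every point of $\mathcal{H}$) and $K_{\mathcal{H}}$ denotes all sectional curvatures of $(\mathcal{H},g_{\mathcal{H}})$ (the inequality holding for every tangent $2$-plane at every point).
   Context: Let $h:\mathbb{R}^{n+1}\to\mathbb{R}$ be a homogeneous cubic polynomial and $\partial^2h_p$ its Hessian bilinear form at $p$. A point $p$ with $h(p)>0$ is a hyperbolic point of $h$ if $-\partial^2h_p$ has signature $(n,1)$ ($n$ positive, one negative direction). An $n$-dimensional CCPSR (closed connected projective special real) manifold is a nonempty (relatively) open subset $\mathcal{H}$ of a level set $\{h=1\}\subset\mathbb{R}^{n+1}$ of such an $h$, consisting only of hyperbolic points of $h$, which is connected and closed as a subset of $\mathbb{R}^{n+1}$. It is equipped with its centro-affine fundamental form, the Riemannian metric $g_{\mathcal{H}}=-\frac{1}{3}\partial^2h|_{T\mathcal{H}\times T\mathcal{H}}$. *)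

theory Defs
  imports "HOL-Analysis.Analysis"
begin

definition homogeneous_cubic :: "(real ^ 'm \<Rightarrow> real) \<Rightarrow> bool" where
  "homogeneous_cubic h \<longleftrightarrow>
     (\<exists>c :: 'm \<Rightarrow> 'm \<Rightarrow> 'm \<Rightarrow> real.
        \<forall>x. h x = (\<Sum>i\<in>UNIV. \<Sum>j\<in>UNIV. \<Sum>k\<in>UNIV. c i j k * x $ i * x $ j * x $ k))"

definition hessian_form :: "('a::real_normed_vector \<Rightarrow> real) \<Rightarrow> 'a \<Rightarrow> 'a \<Rightarrow> 'a \<Rightarrow> real" where
  "hessian_form h p v w =
     frechet_derivative (\<lambda>q. frechet_derivative h (at q) v) (at p) w"

text \<open>Since \<open>P \<union> N\<close> is a basis, a form with a signature in this sense is nondegenerate;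
  by Sylvester's law the pair \<open>(r, s)\<close> does not depend on the diagonalising basis.\<close>

definition has_signature :: "('a::euclidean_space \<Rightarrow> 'a \<Rightarrow> real) \<Rightarrow> nat \<Rightarrow> nat \<Rightarrow> bool" where
  "has_signature B r s \<longleftrightarrow>
     bilinear B \<and> (\<forall>v w. B v w = B w v) \<and>
     (\<exists>P N. finite P \<and> finite N \<and> P \<inter> N = {} \<and> card P = r \<and> card N = s \<and>
        independent (P \<union> N) \<and> span (P \<union> N) = UNIV \<and>
        (\<forall>v\<in>P \<union> N. \<forall>w\<in>P \<union> N. v \<noteq> w \<longrightarrow> B v w = 0) \<and>
        (\<forall>v\<in>P. B v v > 0) \<and> (\<forall>v\<in>N. B v v < 0))"

definition hyperbolic_point :: "(real ^ 'm \<Rightarrow> real) \<Rightarrow> real ^ 'm \<Rightarrow> bool" where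
  "hyperbolic_point h p \<longleftrightarrow>
     h p > 0 \<and> has_signature (\<lambda>v w. - hessian_form h p v w) (CARD('m) - 1) 1"

text \<open>The manifold has dimension \<open>CARD('m) - 1\<close>. The polynomial \<open>h\<close> is carried along because it
  determines the metric.\<close>

definition ccpsr_manifold :: "(real ^ 'm \<Rightarrow> real) \<Rightarrow> (real ^ 'm) set \<Rightarrow> bool" where
  "ccpsr_manifold h H \<longleftrightarrow>
     homogeneous_cubic h \<and>
     H \<noteq> {} \<and> openin (top_of_set {x. h x = 1}) H \<and>
     (\<forall>p\<in>H. hyperbolic_point h p) \<and>
     connected H \<and> closed H"

definition centro_affine_form :: "('a::real_normed_vector \<Rightarrow> real) \<Rightarrow> 'a \<Rightarrow> 'a \<Rightarrow> 'a \<Rightarrow> real" where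
  "centro_affine_form h p v w = - (1 / 3) * hessian_form h p v w"

primrec Ck_on :: "nat \<Rightarrow> 'a::euclidean_space set \<Rightarrow> ('a \<Rightarrow> 'b::euclidean_space) \<Rightarrow> bool" where
  "Ck_on 0 U f \<longleftrightarrow> continuous_on U f"
| "Ck_on (Suc k) U f \<longleftrightarrow>
     (\<forall>x\<in>U. f differentiable (at x)) \<and>
     (\<forall>v. Ck_on k U (\<lambda>x. frechet_derivative f (at x) v))"

definition smooth_on :: "'a::euclidean_space set \<Rightarrow> ('a \<Rightarrow> 'b::euclidean_space) \<Rightarrow> bool" where
  "smooth_on U f \<longleftrightarrow> (\<forall>k. Ck_on k U f)"

text \<open>A local parametrization is the inverse of a chart of the embedded submanifold \<open>H\<close>.\<close>

definition local_parametrization ::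
  "'b::euclidean_space set \<Rightarrow> 'a::euclidean_space set \<Rightarrow> ('a \<Rightarrow> 'b) \<Rightarrow> bool" where
  "local_parametrization H U \<phi> \<longleftrightarrow>
     open U \<and> smooth_on U \<phi> \<and>
     (\<forall>x\<in>U. inj (frechet_derivative \<phi> (at x))) \<and>
     openin (top_of_set H) (\<phi> ` U) \<and>
     (\<exists>\<psi>. homeomorphism U (\<phi> ` U) \<phi> \<psi>)"

definition partial_deriv :: "'n::finite \<Rightarrow> (real ^ 'n \<Rightarrow> real) \<Rightarrow> real ^ 'n \<Rightarrow> real" where
  "partial_deriv i f x = frechet_derivative f (at x) (axis i 1)"

definition metric_coords ::
  "(real ^ 'm \<Rightarrow> real) \<Rightarrow> (real ^ 'n \<Rightarrow> real ^ 'm) \<Rightarrow> real ^ 'n \<Rightarrow> real ^ 'n ^ 'n" where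
  "metric_coords h \<phi> x =
     (\<chi> i j. centro_affine_form h (\<phi> x)
        (frechet_derivative \<phi> (at x) (axis i 1)) (frechet_derivative \<phi> (at x) (axis j 1)))"

text \<open>From here on \<open>g\<close> is the coordinate matrix of a Riemannian metric on an open subset of
  \<open>\<real>\<^sup>n\<close>. Sign and index conventions: \<open>christoffel g k i j\<close> is \<open>\<Gamma>\<close> with upper index \<open>k\<close>,
  \<open>riemann g l k i j\<close> is the \<open>l\<close>-component of
  \<open>R(\<partial>\<^sub>i, \<partial>\<^sub>j) \<partial>\<^sub>k\<close> with \<open>R(X,Y) = [\<nabla>\<^sub>X, \<nabla>\<^sub>Y] - \<nabla>\<close> along \<open>[X,Y]\<close>, and
  \<open>Ric(Y,Z)\<close> is the trace of \<open>X \<mapsto> R(X,Y)Z\<close>; round spheres have positive curvature.\<close>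

definition christoffel ::
  "(real ^ 'n \<Rightarrow> real ^ 'n ^ 'n) \<Rightarrow> 'n::finite \<Rightarrow> 'n \<Rightarrow> 'n \<Rightarrow> real ^ 'n \<Rightarrow> real" where
  "christoffel g k i j x =
     (1 / 2) * (\<Sum>l\<in>UNIV. matrix_inv (g x) $ k $ l *
        (partial_deriv i (\<lambda>y. g y $ j $ l) x
         + partial_deriv j (\<lambda>y. g y $ i $ l) x
         - partial_deriv l (\<lambda>y. g y $ i $ j) x))"

definition riemann ::
  "(real ^ 'n \<Rightarrow> real ^ 'n ^ 'n) \<Rightarrow> 'n::finite \<Rightarrow> 'n \<Rightarrow> 'n \<Rightarrow> 'n \<Rightarrow> real ^ 'n \<Rightarrow> real" where
  "riemann g l k i j x =
     partial_deriv i (christoffel g l j k) x - partial_deriv j (christoffel g l i k) x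
     + (\<Sum>m\<in>UNIV. christoffel g l i m x * christoffel g m j k x
                 - christoffel g l j m x * christoffel g m i k x)"

definition ricci ::
  "(real ^ 'n \<Rightarrow> real ^ 'n ^ 'n) \<Rightarrow> 'n::finite \<Rightarrow> 'n \<Rightarrow> real ^ 'n \<Rightarrow> real" where
  "ricci g j k x = (\<Sum>i\<in>UNIV. riemann g i k i j x)"

definition scalar_curvature :: "(real ^ 'n \<Rightarrow> real ^ 'n ^ 'n) \<Rightarrow> real ^ 'n::finite \<Rightarrow> real" where
  "scalar_curvature g x = (\<Sum>j\<in>UNIV. \<Sum>k\<in>UNIV. matrix_inv (g x) $ j $ k * ricci g j k x)"

definition metric_inner ::
  "(real ^ 'n \<Rightarrow> real ^ 'n ^ 'n) \<Rightarrow> real ^ 'n::finite \<Rightarrow> real ^ 'n \<Rightarrow> real ^ 'n \<Rightarrow> real" where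
  "metric_inner g x v w = v \<bullet> (g x *v w)"

definition curvature_operator ::
  "(real ^ 'n \<Rightarrow> real ^ 'n ^ 'n) \<Rightarrow> real ^ 'n::finite \<Rightarrow> real ^ 'n \<Rightarrow> real ^ 'n \<Rightarrow> real ^ 'n \<Rightarrow> real ^ 'n" where
  "curvature_operator g x v w z =
     (\<chi> l. \<Sum>i\<in>UNIV. \<Sum>j\<in>UNIV. \<Sum>k\<in>UNIV. riemann g l k i j x * v $ i * w $ j * z $ k)"

definition sectional_curvature ::
  "(real ^ 'n \<Rightarrow> real ^ 'n ^ 'n) \<Rightarrow> real ^ 'n::finite \<Rightarrow> real ^ 'n \<Rightarrow> real ^ 'n \<Rightarrow> real" where
  "sectional_curvature g x v w =
     metric_inner g x (curvature_operator g x v w w) v /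
     (metric_inner g x v v * metric_inner g x w w - (metric_inner g x v w)\<^sup>2)"

end

theory Submission
  imports Defs
begin

text \<open>Write \<open>h x = T(x, x, x)\<close> with \<open>T\<close> symmetric and trilinear. At \<open>p \<in> H\<close> the metric is
  \<open>g(v, w) = -2 T(p, v, w)\<close> on the tangent space \<open>T(p, p, v) = 0\<close>, and the Gauss equation of the
  centro-affine hypersurface gives
  \<open>R(a, b, c, d) = g(a,c) g(b,d) - g(b,c) g(a,d) + g(K(a,c), K(b,d)) - g(K(b,c), K(a,d))\<close>, where
  \<open>g(K(v, w), z) = - T(v, w, z)\<close>. So it suffices to bound \<open>T\<close> on unit tangent vectors by a
  universal constant. If \<open>g(y, y) = 1\<close> and \<open>T(y, y, y) > 1/\<surd>2\<close>, then \<open>h\<close> is positive on the ray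
  \<open>p + t y\<close>, whose central projection therefore stays in the closed and open subset \<open>H\<close> of the level
  set; but \<open>h\<close> is not hyperbolic at \<open>t = 2 T(y, y, y)\<close>.\<close>

subsection \<open>Second derivatives\<close>

lemma smooth_on_differentiable: "smooth_on U f \<Longrightarrow> x \<in> U \<Longrightarrow> f differentiable (at x)"
  unfolding smooth_on_def by (drule spec[of _ "Suc 0"]) simp

lemma smooth_on_continuous: "smooth_on U f \<Longrightarrow> continuous_on U f"
  unfolding smooth_on_def by (drule spec[of _ 0]) simp

lemma smooth_on_frechet_derivative:
  "smooth_on U f \<Longrightarrow> smooth_on U (\<lambda>x. frechet_derivative f (at x) v)"
  unfolding smooth_on_def
proof
  fix k assume "\<forall>k. Ck_on k U f"
  then have "Ck_on (Suc k) U f" ..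
  then show "Ck_on k U (\<lambda>x. frechet_derivative f (at x) v)" by simp
qed

lemma has_real_derivative_along_line:
  fixes f :: "'a::real_normed_vector \<Rightarrow> real"
  assumes "f differentiable (at (a + t *\<^sub>R v))"
  shows "((\<lambda>t. f (a + t *\<^sub>R v)) has_real_derivative frechet_derivative f (at (a + t *\<^sub>R v)) v) (at t)"
proof -
  let ?D = "frechet_derivative f (at (a + t *\<^sub>R v))"
  have f: "(f has_derivative ?D) (at (a + t *\<^sub>R v))"
    using assms frechet_derivative_works by blast
  have "((\<lambda>t. a + t *\<^sub>R v) has_derivative (\<lambda>s. s *\<^sub>R v)) (at t)"
    by (auto intro!: derivative_eq_intros)
  from has_derivative_compose[OF this f]
  have "((\<lambda>t. f (a + t *\<^sub>R v)) has_derivative (\<lambda>s. ?D (s *\<^sub>R v))) (at t)" .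
  moreover have "(\<lambda>s. ?D (s *\<^sub>R v)) = (*) (?D v)"
    using f linear_cmul[OF has_derivative_linear[OF f]] by (auto simp: mult.commute)
  ultimately show ?thesis
    by (simp add: has_field_derivative_def)
qed

lemma mixed_difference_eq:
  fixes f :: "'a::real_normed_vector \<Rightarrow> real"
  assumes f: "\<And>y. y \<in> ball x e \<Longrightarrow> f differentiable (at y)"
    and f': "\<And>y. y \<in> ball x e \<Longrightarrow> (\<lambda>y. frechet_derivative f (at y) v) differentiable (at y)"
    and s: "0 < s" "s * (norm v + norm w) < e"
  shows "\<exists>a\<in>ball x e. f (x + s *\<^sub>R v + s *\<^sub>R w) - f (x + s *\<^sub>R v) - f (x + s *\<^sub>R w) + f x =
    s\<^sup>2 * frechet_derivative (\<lambda>y. frechet_derivative f (at y) v) (at a) w"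
proof -
  have mem: "x + t *\<^sub>R v + r *\<^sub>R w \<in> ball x e" if "0 \<le> t" "t \<le> s" "0 \<le> r" "r \<le> s" for t r
  proof -
    have "norm (t *\<^sub>R v + r *\<^sub>R w) \<le> t * norm v + r * norm w"
      using that by (intro norm_triangle_le) auto
    also have "\<dots> \<le> s * norm v + s * norm w"
      using that by (intro add_mono mult_right_mono) auto
    also have "\<dots> < e" using s by (simp add: algebra_simps)
    finally show ?thesis by (simp add: dist_norm norm_minus_commute add.assoc add.commute)
  qed
  define D where "D = (\<lambda>y. frechet_derivative f (at y) v)"
  have d1: "((\<lambda>t. f ((x + s *\<^sub>R w) + t *\<^sub>R v) - f (x + t *\<^sub>R v)) has_real_derivative
      D ((x + s *\<^sub>R w) + t *\<^sub>R v) - D (x + t *\<^sub>R v)) (at t)" if "0 \<le> t" "t \<le> s" for t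
    unfolding D_def using that mem[of t s] mem[of t 0] s
    by (intro DERIV_diff has_real_derivative_along_line f) (auto simp: algebra_simps)
  obtain z where z: "0 < z" "z < s"
    and z1: "(f ((x + s *\<^sub>R w) + s *\<^sub>R v) - f (x + s *\<^sub>R v)) - (f ((x + s *\<^sub>R w) + 0 *\<^sub>R v) - f (x + 0 *\<^sub>R v))
       = (s - 0) * (D ((x + s *\<^sub>R w) + z *\<^sub>R v) - D (x + z *\<^sub>R v))"
    using MVT2[OF s(1), of "\<lambda>t. f ((x + s *\<^sub>R w) + t *\<^sub>R v) - f (x + t *\<^sub>R v)", OF d1]
    by (metis less_imp_le)
  have d2: "((\<lambda>t. D ((x + z *\<^sub>R v) + t *\<^sub>R w)) has_real_derivative
      frechet_derivative D (at ((x + z *\<^sub>R v) + t *\<^sub>R w)) w) (at t)" if "0 \<le> t" "t \<le> s" for t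
    using that mem[of z t] z unfolding D_def
    by (intro has_real_derivative_along_line f') auto
  obtain r where r: "0 < r" "r < s"
    and r1: "D ((x + z *\<^sub>R v) + s *\<^sub>R w) - D ((x + z *\<^sub>R v) + 0 *\<^sub>R w)
       = (s - 0) * frechet_derivative D (at ((x + z *\<^sub>R v) + r *\<^sub>R w)) w"
    using MVT2[OF s(1), of "\<lambda>t. D ((x + z *\<^sub>R v) + t *\<^sub>R w)", OF d2]
    by (metis less_imp_le)
  have "f (x + s *\<^sub>R v + s *\<^sub>R w) - f (x + s *\<^sub>R v) - f (x + s *\<^sub>R w) + f x
      = s\<^sup>2 * frechet_derivative D (at (x + z *\<^sub>R v + r *\<^sub>R w)) w"
    using z1 r1 by (simp add: algebra_simps power2_eq_square)
  moreover have "x + z *\<^sub>R v + r *\<^sub>R w \<in> ball x e" using mem z r by simp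
  ultimately show ?thesis unfolding D_def by blast
qed

lemma second_derivative_symmetric_real:
  fixes f :: "'a::real_normed_vector \<Rightarrow> real"
  assumes U: "open U" "x \<in> U"
    and f: "\<And>y. y \<in> U \<Longrightarrow> f differentiable (at y)"
    and f': "\<And>y v. y \<in> U \<Longrightarrow> (\<lambda>y. frechet_derivative f (at y) v) differentiable (at y)"
    and cont: "\<And>v w. continuous_on U (\<lambda>y. frechet_derivative (\<lambda>y. frechet_derivative f (at y) v) (at y) w)"
  shows "frechet_derivative (\<lambda>y. frechet_derivative f (at y) v) (at x) w
       = frechet_derivative (\<lambda>y. frechet_derivative f (at y) w) (at x) v"
proof (rule ccontr)
  define D where "D v w y = frechet_derivative (\<lambda>y. frechet_derivative f (at y) v) (at y) w" for v w y
  assume "\<not> ?thesis"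
  then have ne: "0 < \<bar>D v w x - D w v x\<bar>" unfolding D_def by simp
  let ?\<epsilon> = "\<bar>D v w x - D w v x\<bar> / 2"
  have c: "continuous (at x) (D v w)" for v w
    using cont U continuous_on_eq_continuous_at unfolding D_def by blast
  obtain e0 where e0: "e0 > 0" "ball x e0 \<subseteq> U" using U open_contains_ball by blast
  obtain e1 where e1: "e1 > 0" "\<And>y. dist y x < e1 \<Longrightarrow> dist (D v w y) (D v w x) < ?\<epsilon>"
    using c[of v w] ne unfolding continuous_at_eps_delta by (metis half_gt_zero)
  obtain e2 where e2: "e2 > 0" "\<And>y. dist y x < e2 \<Longrightarrow> dist (D w v y) (D w v x) < ?\<epsilon>"
    using c[of w v] ne unfolding continuous_at_eps_delta by (metis half_gt_zero)
  define e where "e = min e0 (min e1 e2)"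
  have e: "e > 0" using e0 e1 e2 by (simp add: e_def)
  define s where "s = e / (2 * (norm v + norm w + 1))"
  have n: "norm v + norm w + 1 > 0" by (simp add: add_nonneg_pos)
  have s: "s > 0" using e n by (simp add: s_def)
  have "s * (norm v + norm w) \<le> s * (norm v + norm w + 1)" using s by simp
  also have "\<dots> = e / 2" unfolding s_def using n by (simp only: times_divide_eq_left) (simp add: divide_simps)
  also have "\<dots> < e" using e by simp
  finally have s2: "s * (norm v + norm w) < e" .
  have fe: "f differentiable (at y)" if "y \<in> ball x e" for y
    using that f e0 by (auto simp: e_def)
  have fe': "(\<lambda>y. frechet_derivative f (at y) v) differentiable (at y)" if "y \<in> ball x e" for y v
    using that f' e0 by (auto simp: e_def)
  obtain a where a: "a \<in> ball x e" "f (x + s *\<^sub>R v + s *\<^sub>R w) - f (x + s *\<^sub>R v) - f (x + s *\<^sub>R w) + f x =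
    s\<^sup>2 * D v w a"
    using mixed_difference_eq[of x e f v s w, OF fe fe' s s2] unfolding D_def by blast
  obtain b where b: "b \<in> ball x e" "f (x + s *\<^sub>R w + s *\<^sub>R v) - f (x + s *\<^sub>R w) - f (x + s *\<^sub>R v) + f x =
    s\<^sup>2 * D w v b"
    using mixed_difference_eq[of x e f w s v, OF fe fe' s] s2 unfolding D_def by (metis add.commute)
  have "s\<^sup>2 * D v w a = s\<^sup>2 * D w v b" using a(2) b(2) by (simp add: algebra_simps)
  then have "D v w a = D w v b" using s by simp
  moreover have "dist (D v w a) (D v w x) < ?\<epsilon>" "dist (D w v b) (D w v x) < ?\<epsilon>"
    using a(1) b(1) e1(2)[of a] e2(2)[of b] by (simp_all add: e_def dist_commute)
  ultimately show False by (simp add: dist_real_def abs_if split: if_splits)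
qed

lemma frechet_derivative_eqI: "(f has_derivative f') (at x) \<Longrightarrow> frechet_derivative f (at x) = f'"
  by (rule frechet_derivative_at[symmetric])

lemma frechet_derivative_inner_right:
  assumes "f differentiable (at x)"
  shows "frechet_derivative (\<lambda>y. f y \<bullet> b) (at x) = (\<lambda>v. frechet_derivative f (at x) v \<bullet> b)"
  using assms unfolding frechet_derivative_works
  by (intro frechet_derivative_eqI has_derivative_inner_left)

lemma differentiable_cong_open:
  assumes "open U" "x \<in> U" "\<And>y. y \<in> U \<Longrightarrow> f y = g y" "f differentiable (at x)"
  shows "g differentiable (at x)"
  using assms has_derivative_transform_within_open[of f _ x UNIV U g]
  unfolding differentiable_def by blast

lemma frechet_derivative_cong_open:
  assumes "open U" "x \<in> U" "\<And>y. y \<in> U \<Longrightarrow> f y = g y"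
  shows "frechet_derivative f (at x) = frechet_derivative g (at x)"
proof -
  have "(f has_derivative D) (at x) \<longleftrightarrow> (g has_derivative D) (at x)" for D
    using has_derivative_transform_within_open[of f D x UNIV U g]
      has_derivative_transform_within_open[of g D x UNIV U f] assms by auto
  then show ?thesis unfolding frechet_derivative_def by simp
qed

lemma second_derivative_symmetric:
  fixes f :: "'a::euclidean_space \<Rightarrow> 'b::euclidean_space"
  assumes U: "open U" "x \<in> U" and f: "smooth_on U f"
  shows "frechet_derivative (\<lambda>y. frechet_derivative f (at y) v) (at x) w
       = frechet_derivative (\<lambda>y. frechet_derivative f (at y) w) (at x) v"
proof (rule euclidean_eqI)
  fix b :: 'b assume "b \<in> Basis"
  define fb where "fb = (\<lambda>y. f y \<bullet> b)"
  have d1: "frechet_derivative fb (at y) v = frechet_derivative f (at y) v \<bullet> b" if "y \<in> U" for y v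
    unfolding fb_def using frechet_derivative_inner_right smooth_on_differentiable[OF f that] by metis
  have sm: "smooth_on U (\<lambda>y. frechet_derivative f (at y) v)" for v
    using smooth_on_frechet_derivative[OF f] .
  have d2: "frechet_derivative (\<lambda>y. frechet_derivative fb (at y) v) (at y) w
      = frechet_derivative (\<lambda>y. frechet_derivative f (at y) v) (at y) w \<bullet> b" if "y \<in> U" for y v w
  proof -
    have "frechet_derivative (\<lambda>y. frechet_derivative fb (at y) v) (at y)
       = frechet_derivative (\<lambda>y. frechet_derivative f (at y) v \<bullet> b) (at y)"
      by (rule frechet_derivative_cong_open[OF U(1) that]) (rule d1)
    then show ?thesis
      by (simp add: frechet_derivative_inner_right[OF smooth_on_differentiable[OF sm that]])
  qed
  have "frechet_derivative (\<lambda>y. frechet_derivative fb (at y) v) (at x) w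
       = frechet_derivative (\<lambda>y. frechet_derivative fb (at y) w) (at x) v"
  proof (rule second_derivative_symmetric_real[OF U])
    show "fb differentiable at y" if "y \<in> U" for y
      unfolding fb_def using smooth_on_differentiable[OF f that] by simp
    show "(\<lambda>y. frechet_derivative fb (at y) v) differentiable at y" if "y \<in> U" for y v
    proof (rule differentiable_cong_open[OF U(1) that])
      show "(\<lambda>y. frechet_derivative f (at y) v \<bullet> b) differentiable at y"
        using smooth_on_differentiable[OF sm that] by simp
    qed (simp add: d1)
    show "continuous_on U (\<lambda>y. frechet_derivative (\<lambda>y. frechet_derivative fb (at y) v) (at y) w)" for v w
    proof (subst continuous_on_cong[OF refl d2])
      show "continuous_on U (\<lambda>y. frechet_derivative (\<lambda>y. frechet_derivative f (at y) v) (at y) w \<bullet> b)"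
        using smooth_on_continuous[OF smooth_on_frechet_derivative[OF sm]]
        by (intro continuous_intros)
    qed
  qed
  then show "frechet_derivative (\<lambda>y. frechet_derivative f (at y) v) (at x) w \<bullet> b
       = frechet_derivative (\<lambda>y. frechet_derivative f (at y) w) (at x) v \<bullet> b"
    using d2 U(2) by simp
qed

subsection \<open>The Riemann tensor with lowered index\<close>

lemma differentiable_prod_real:
  fixes f :: "'i \<Rightarrow> 'a::real_normed_vector \<Rightarrow> real"
  assumes "\<And>i. i \<in> I \<Longrightarrow> f i differentiable (at x)"
  shows "(\<lambda>y. \<Prod>i\<in>I. f i y) differentiable (at x)"
proof -
  have "\<exists>D. \<forall>i\<in>I. (f i has_derivative D i) (at x)"
    using assms unfolding differentiable_def by metis
  then obtain D where "\<And>i. i \<in> I \<Longrightarrow> (f i has_derivative D i) (at x)" by blast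
  then have "((\<lambda>y. \<Prod>i\<in>I. f i y) has_derivative (\<lambda>v. \<Sum>i\<in>I. D i v * (\<Prod>j\<in>I - {i}. f j x))) (at x)"
    by (rule has_derivative_prod)
  then show ?thesis unfolding differentiable_def by blast
qed

lemma differentiable_det:
  fixes M :: "'a::real_normed_vector \<Rightarrow> real ^ 'n ^ 'n"
  assumes "\<And>i j. (\<lambda>y. M y $ i $ j) differentiable (at x)"
  shows "(\<lambda>y. det (M y)) differentiable (at x)"
  unfolding det_def
  by (intro differentiable_sum ballI differentiable_mult differentiable_prod_real assms differentiable_const)
    (simp add: finite_permutations)

lemma matrix_inv_inverse:
  fixes A :: "real ^ 'n ^ 'n"
  assumes "invertible A"
  shows "A ** matrix_inv A = mat 1" "matrix_inv A ** A = mat 1"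
  using someI_ex[OF assms[unfolded invertible_def]] unfolding matrix_inv_def by auto

lemma matrix_inv_component:
  fixes A :: "real ^ 'n ^ 'n"
  assumes "invertible A"
  shows "matrix_inv A $ k $ l = det (\<chi> i j. if j = k then axis l 1 $ i else A $ i $ j) / det A"
proof -
  have "A *v (matrix_inv A *v axis l 1) = axis l 1"
    by (simp add: matrix_vector_mul_assoc matrix_inv_inverse[OF assms])
  moreover have "det A \<noteq> 0" using assms by (simp add: invertible_det_nz)
  ultimately have "matrix_inv A *v axis l 1
      = (\<chi> k. det (\<chi> i j. if j = k then axis l 1 $ i else A $ i $ j) / det A)"
    using cramer by blast
  then have "(matrix_inv A *v axis l 1) $ k = det (\<chi> i j. if j = k then axis l 1 $ i else A $ i $ j) / det A"
    by simp
  then show ?thesis by (simp add: matrix_vector_mul_component inner_axis)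
qed

lemma differentiable_matrix_inv:
  fixes G :: "'a::real_normed_vector \<Rightarrow> real ^ 'n ^ 'n"
  assumes U: "open U" "x \<in> U" and inv: "\<And>y. y \<in> U \<Longrightarrow> invertible (G y)"
    and G: "\<And>i j. (\<lambda>y. G y $ i $ j) differentiable (at x)"
  shows "(\<lambda>y. matrix_inv (G y) $ k $ l) differentiable (at x)"
proof (rule differentiable_cong_open[OF U])
  show "det (\<chi> i j. if j = k then axis l 1 $ i else G y $ i $ j) / det (G y) = matrix_inv (G y) $ k $ l"
    if "y \<in> U" for y using matrix_inv_component[OF inv[OF that]] by simp
  have e: "(\<lambda>y. (\<chi> i j. if j = k then axis l 1 $ i else G y $ i $ j) $ i $ j) differentiable (at x)" for i j
    using G by (cases "j = k") simp_all
  have "det (G x) \<noteq> 0" using inv[OF U(2)] by (simp add: invertible_det_nz)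
  then show "(\<lambda>y. det (\<chi> i j. if j = k then axis l 1 $ i else G y $ i $ j) / det (G y)) differentiable (at x)"
    by (intro differentiable_divide differentiable_det e G)
qed

lemma partial_deriv_eqI: "(f has_derivative f') (at x) \<Longrightarrow> partial_deriv i f x = f' (axis i 1)"
  unfolding partial_deriv_def by (simp add: frechet_derivative_eqI)

lemma partial_deriv_cong_open:
  "open U \<Longrightarrow> x \<in> U \<Longrightarrow> (\<And>y. y \<in> U \<Longrightarrow> f y = g y) \<Longrightarrow> partial_deriv i f x = partial_deriv i g x"
  unfolding partial_deriv_def by (simp add: frechet_derivative_cong_open[of U x f g])

lemma partial_deriv_mult:
  assumes "f differentiable (at x)" "g differentiable (at x)"
  shows "partial_deriv i (\<lambda>y. f y * g y) x = partial_deriv i f x * g x + f x * partial_deriv i g x"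
  unfolding partial_deriv_def
  by (subst frechet_derivative_eqI[OF has_derivative_mult[OF assms[unfolded frechet_derivative_works]]]) simp

lemma partial_deriv_sum:
  assumes "\<And>k. k \<in> I \<Longrightarrow> f k differentiable (at x)"
  shows "partial_deriv i (\<lambda>y. \<Sum>k\<in>I. f k y) x = (\<Sum>k\<in>I. partial_deriv i (f k) x)"
proof -
  have "((\<lambda>y. \<Sum>k\<in>I. f k y) has_derivative (\<lambda>v. \<Sum>k\<in>I. frechet_derivative (f k) (at x) v)) (at x)"
    using assms unfolding frechet_derivative_works by (rule has_derivative_sum)
  then show ?thesis unfolding partial_deriv_def by (simp add: frechet_derivative_eqI)
qed

definition christoffel_lower ::
  "(real ^ 'n \<Rightarrow> real ^ 'n ^ 'n) \<Rightarrow> 'n::finite \<Rightarrow> 'n \<Rightarrow> 'n \<Rightarrow> real ^ 'n \<Rightarrow> real" where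
  "christoffel_lower g m i j x =
     (1 / 2) * (partial_deriv i (\<lambda>y. g y $ j $ m) x + partial_deriv j (\<lambda>y. g y $ i $ m) x
       - partial_deriv m (\<lambda>y. g y $ i $ j) x)"

lemma christoffel_eq:
  "christoffel g k i j x = (\<Sum>l\<in>UNIV. matrix_inv (g x) $ k $ l * christoffel_lower g l i j x)"
  unfolding christoffel_def christoffel_lower_def by (simp add: sum_distrib_left mult_ac)

lemma lower_christoffel:
  assumes "invertible (g x)"
  shows "(\<Sum>l\<in>UNIV. g x $ m $ l * christoffel g l i j x) = christoffel_lower g m i j x"
proof -
  have "(\<chi> l. christoffel g l i j x) = matrix_inv (g x) *v (\<chi> l. christoffel_lower g l i j x)"
    by (simp add: vec_eq_iff matrix_vector_mult_def christoffel_eq)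
  then have "g x *v (\<chi> l. christoffel g l i j x) = (\<chi> l. christoffel_lower g l i j x)"
    by (simp add: matrix_vector_mul_assoc matrix_inv_inverse[OF assms])
  then have "(g x *v (\<chi> l. christoffel g l i j x)) $ m = christoffel_lower g m i j x" by simp
  then show ?thesis by (simp add: matrix_vector_mult_def)
qed

lemma lower_riemann:
  fixes g :: "real ^ 'n \<Rightarrow> real ^ 'n ^ 'n"
  assumes U: "open U" "x \<in> U"
    and inv: "\<And>y. y \<in> U \<Longrightarrow> invertible (g y)"
    and sym: "\<And>y i j. y \<in> U \<Longrightarrow> g y $ i $ j = g y $ j $ i"
    and d1: "\<And>i j. (\<lambda>y. g y $ i $ j) differentiable (at x)"
    and d2: "\<And>i j k. partial_deriv k (\<lambda>y. g y $ i $ j) differentiable (at x)"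
  shows "(\<Sum>l\<in>UNIV. g x $ m $ l * riemann g l k i j x) =
    partial_deriv i (christoffel_lower g m j k) x - partial_deriv j (christoffel_lower g m i k) x
    - (\<Sum>q\<in>UNIV. christoffel_lower g q i m x * christoffel g q j k x
                - christoffel_lower g q j m x * christoffel g q i k x)"
proof -
  have cl: "christoffel_lower g m i j differentiable (at x)" for m i j
    unfolding christoffel_lower_def using d2 by simp
  have c: "christoffel g k i j differentiable (at x)" for k i j
    unfolding christoffel_eq using differentiable_matrix_inv[OF U inv d1] cl
    by (intro differentiable_sum differentiable_mult) auto
  have dg: "partial_deriv i (\<lambda>y. g y $ m $ l) x = christoffel_lower g m i l x + christoffel_lower g l i m x"
    for i m l
  proof -
    have "partial_deriv k (\<lambda>y. g y $ a $ b) x = partial_deriv k (\<lambda>y. g y $ b $ a) x" for k a b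
      using partial_deriv_cong_open[OF U sym] .
    from this[of i m l] this[of l i m] this[of m i l] show ?thesis
      unfolding christoffel_lower_def by (simp add: field_simps)
  qed
  have key: "(\<Sum>l\<in>UNIV. g x $ m $ l * partial_deriv i (christoffel g l j k) x) =
     partial_deriv i (christoffel_lower g m j k) x
     - (\<Sum>l\<in>UNIV. (christoffel_lower g m i l x + christoffel_lower g l i m x) * christoffel g l j k x)"
    for i j
  proof -
    have "partial_deriv i (christoffel_lower g m j k) x
       = partial_deriv i (\<lambda>y. \<Sum>l\<in>UNIV. g y $ m $ l * christoffel g l j k y) x"
      by (rule partial_deriv_cong_open[OF U]) (simp add: lower_christoffel[where g=g, OF inv])
    also have "\<dots> = (\<Sum>l\<in>UNIV. partial_deriv i (\<lambda>y. g y $ m $ l) x * christoffel g l j k x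
        + g x $ m $ l * partial_deriv i (christoffel g l j k) x)"
      by (subst partial_deriv_sum) (auto intro!: differentiable_mult d1 c simp: partial_deriv_mult d1 c)
    finally show ?thesis by (simp add: dg sum.distrib)
  qed
  have quad: "(\<Sum>l\<in>UNIV. g x $ m $ l * (\<Sum>q\<in>UNIV. christoffel g l i q x * christoffel g q j k x))
      = (\<Sum>q\<in>UNIV. christoffel_lower g m i q x * christoffel g q j k x)" for i j
  proof -
    have "(\<Sum>l\<in>UNIV. g x $ m $ l * (\<Sum>q\<in>UNIV. christoffel g l i q x * christoffel g q j k x))
      = (\<Sum>q\<in>UNIV. (\<Sum>l\<in>UNIV. g x $ m $ l * christoffel g l i q x) * christoffel g q j k x)"
      unfolding sum_distrib_left sum_distrib_right by (subst sum.swap) (simp add: mult_ac)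
    then show ?thesis by (simp add: lower_christoffel[where g=g, OF inv[OF U(2)]])
  qed
  show ?thesis
    unfolding riemann_def
    using key[of i j] key[of j i] quad[of i j] quad[of j i]
    by (simp add: algebra_simps sum.distrib sum_subtractf)
qed

subsection \<open>The bound on the cubic form\<close>

lemma has_signature_one_negative:
  fixes B :: "'a::euclidean_space \<Rightarrow> 'a \<Rightarrow> real"
  assumes sig: "has_signature B r 1" and p: "B p p < 0" and pv: "B p v = 0" and v: "v \<noteq> 0"
  shows "B v v > 0"
proof -
  obtain P N where PN: "bilinear B" "\<And>v w. B v w = B w v" "finite P" "card N = 1" "finite N"
    "span (P \<union> N) = UNIV" "\<And>v w. v \<in> P \<union> N \<Longrightarrow> w \<in> P \<union> N \<Longrightarrow> v \<noteq> w \<Longrightarrow> B v w = 0"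
    "\<And>v. v \<in> P \<Longrightarrow> B v v > 0"
    using sig unfolding has_signature_def by blast
  obtain a where a: "N = {a}" using PN(4) card_1_singletonE by blast
  have sp: "\<exists>k. x - k *\<^sub>R a \<in> span P" for x
    using PN(6) span_insert[of a P] unfolding a by auto
  have pos: "B w w \<ge> 0 \<and> (B w w = 0 \<longrightarrow> w = 0)" if ws: "w \<in> span P" for w
  proof -
    obtain u where u: "w = (\<Sum>b\<in>P. u b *\<^sub>R b)"
      using ws unfolding span_finite[OF PN(3)] by blast
    have "B w w = (\<Sum>b\<in>P. \<Sum>c\<in>P. B (u b *\<^sub>R b) (u c *\<^sub>R c))"
      unfolding u bilinear_sum[OF PN(1)] by (simp add: sum.cartesian_product)
    also have "\<dots> = (\<Sum>b\<in>P. \<Sum>c\<in>P. if c = b then (u b)\<^sup>2 * B b b else 0)"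
    proof (intro sum.cong refl)
      fix b c assume "b \<in> P" "c \<in> P"
      then show "B (u b *\<^sub>R b) (u c *\<^sub>R c) = (if c = b then (u b)\<^sup>2 * B b b else 0)"
        using PN(7)[of b c]
        by (auto simp: bilinear_lmul[OF PN(1)] bilinear_rmul[OF PN(1)] power2_eq_square)
    qed
    finally have e: "B w w = (\<Sum>b\<in>P. (u b)\<^sup>2 * B b b)" using PN(3) by simp
    have nn: "(u b)\<^sup>2 * B b b \<ge> 0" if "b \<in> P" for b using PN(8)[OF that] by simp
    have "w = 0" if "B w w = 0"
    proof -
      have "(u b)\<^sup>2 * B b b = 0" if "b \<in> P" for b
        using sum_nonneg_eq_0_iff[OF PN(3), of "\<lambda>b. (u b)\<^sup>2 * B b b"] nn e \<open>B w w = 0\<close> that by auto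
      then have "u b = 0" if "b \<in> P" for b using PN(8)[OF that] that by fastforce
      then show "w = 0" unfolding u by simp
    qed
    moreover have "B w w \<ge> 0" unfolding e using nn by (rule sum_nonneg)
    ultimately show ?thesis by blast
  qed
  obtain k where k: "p - k *\<^sub>R a \<in> span P" using sp by blast
  obtain l where l: "v - l *\<^sub>R a \<in> span P" using sp by blast
  have "k \<noteq> 0" using pos[of p] k p by auto
  define w where "w = v - (l / k) *\<^sub>R p"
  have "w = (v - l *\<^sub>R a) - (l / k) *\<^sub>R (p - k *\<^sub>R a)"
    using \<open>k \<noteq> 0\<close> by (simp add: w_def scaleR_diff_right)
  then have w: "w \<in> span P" using k l by (simp add: span_diff span_scale)
  have "B w w = B v v + (l / k)\<^sup>2 * B p p"
    unfolding w_def using pv PN(2)[of v p]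
    by (simp add: bilinear_lsub[OF PN(1)] bilinear_rsub[OF PN(1)] bilinear_lmul[OF PN(1)]
        bilinear_rmul[OF PN(1)] power2_eq_square)
  then have e: "B v v = B w w + (l / k)\<^sup>2 * (- B p p)" by simp
  have n: "B w w \<ge> 0" "(l / k)\<^sup>2 * (- B p p) \<ge> 0" using pos[OF w] p by (auto simp: mult_nonneg_nonpos)
  show ?thesis
  proof (rule ccontr)
    assume "\<not> ?thesis"
    then have z: "B w w = 0" "(l / k)\<^sup>2 * (- B p p) = 0" using e n by linarith+
    then have "w = 0" "l / k = 0" using pos[OF w] p by auto
    then show False using v by (simp add: w_def)
  qed
qed

definition trilin :: "('m::finite \<Rightarrow> 'm \<Rightarrow> 'm \<Rightarrow> real) \<Rightarrow> real ^ 'm \<Rightarrow> real ^ 'm \<Rightarrow> real ^ 'm \<Rightarrow> real" where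
  "trilin t x y z = (\<Sum>i\<in>UNIV. \<Sum>j\<in>UNIV. \<Sum>k\<in>UNIV. t i j k * x $ i * y $ j * z $ k)"

lemma trilin_linear:
  "trilin t (x + x') y z = trilin t x y z + trilin t x' y z"
  "trilin t x (y + y') z = trilin t x y z + trilin t x y' z"
  "trilin t x y (z + z') = trilin t x y z + trilin t x y z'"
  "trilin t (x - x') y z = trilin t x y z - trilin t x' y z"
  "trilin t x (y - y') z = trilin t x y z - trilin t x y' z"
  "trilin t x y (z - z') = trilin t x y z - trilin t x y z'"
  "trilin t (a *\<^sub>R x) y z = a * trilin t x y z"
  "trilin t x (a *\<^sub>R y) z = a * trilin t x y z"
  "trilin t x y (a *\<^sub>R z) = a * trilin t x y z"
  "trilin t (- x) y z = - trilin t x y z"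
  "trilin t x (- y) z = - trilin t x y z"
  "trilin t x y (- z) = - trilin t x y z"
  unfolding trilin_def
  by (simp_all add: algebra_simps sum.distrib sum_subtractf sum_distrib_left sum_negf)

lemma trilin_swap12:
  "trilin t x y z = trilin (\<lambda>i j k. t j i k) y x z"
  unfolding trilin_def by (subst sum.swap) (simp add: mult_ac)

lemma trilin_swap23:
  "trilin t x y z = trilin (\<lambda>i j k. t i k j) x z y"
  unfolding trilin_def by (rule sum.cong[OF refl], subst sum.swap) (simp add: mult_ac)

lemma trilin_coeff_linear:
  "trilin (\<lambda>i j k. a * t i j k) x y z = a * trilin t x y z"
  "trilin (\<lambda>i j k. t i j k + t' i j k) x y z = trilin t x y z + trilin t' x y z"
  unfolding trilin_def by (simp_all add: algebra_simps sum.distrib sum_distrib_left)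

lemma has_derivative_vec_nth [derivative_intros]:
  "(f has_derivative f') F \<Longrightarrow> ((\<lambda>x. f x $ i) has_derivative (\<lambda>v. f' v $ i)) F"
  by (rule bounded_linear.has_derivative[OF bounded_linear_vec_nth])

lemma has_derivative_trilin:
  assumes "(f has_derivative f') (at x)" "(g has_derivative g') (at x)" "(k has_derivative k') (at x)"
  shows "((\<lambda>y. trilin t (f y) (g y) (k y)) has_derivative
     (\<lambda>v. trilin t (f' v) (g x) (k x) + trilin t (f x) (g' v) (k x) + trilin t (f x) (g x) (k' v))) (at x)"
  unfolding trilin_def using assms
  by (auto intro!: derivative_eq_intros simp: algebra_simps sum.distrib)

locale cubic_form =
  fixes h :: "real ^ 'm::finite \<Rightarrow> real" and t :: "'m \<Rightarrow> 'm \<Rightarrow> 'm \<Rightarrow> real"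
  assumes h_eq: "h x = trilin t x x x"
    and coeff_swap12: "t i j k = t j i k"
    and coeff_swap23: "t i j k = t i k j"
begin

abbreviation T where "T \<equiv> trilin t"

lemma T_swap12: "T x y z = T y x z"
  using trilin_swap12[of t x y z] coeff_swap12[abs_def] by metis

lemma T_swap23: "T x y z = T x z y"
  using trilin_swap23[of t x y z] coeff_swap23[abs_def] by metis

lemma T_rotate: "T x y z = T y z x" "T x y z = T z x y" "T x y z = T z y x"
  using T_swap12 T_swap23 by metis+

lemma hessian_form_eq: "hessian_form h p v w = 6 * T p v w"
proof -
  have "(h has_derivative (\<lambda>v. 3 * T q q v)) (at q)" for q
  proof -
    have "((\<lambda>y. T y y y) has_derivative (\<lambda>v. T v q q + T q v q + T q q v)) (at q)"
      by (intro has_derivative_trilin has_derivative_ident)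
    moreover have "T v q q + T q v q + T q q v = 3 * T q q v" for v
      using T_rotate[of v q q] T_swap23[of q v q] by simp
    ultimately show ?thesis using h_eq[abs_def] by simp
  qed
  then have "frechet_derivative h (at q) = (\<lambda>v. 3 * T q q v)" for q
    by (rule frechet_derivative_eqI)
  then have "hessian_form h p v w = frechet_derivative (\<lambda>q. 3 * T q q v) (at p) w"
    unfolding hessian_form_def by simp
  moreover have "((\<lambda>q. T q q v) has_derivative (\<lambda>w. T w p v + T p w v + T p p 0)) (at p)"
    by (intro has_derivative_trilin has_derivative_ident has_derivative_const)
  from has_derivative_mult_right[OF this, of 3]
  have "((\<lambda>q. 3 * T q q v) has_derivative (\<lambda>w. 3 * (T w p v + T p w v + T p p 0))) (at p)" .
  ultimately show ?thesis
    using T_rotate[of w p v] T_swap23[of p w v] trilin_linear(7)[of t 0 p p p] trilin_linear(9)[of t p p 0 p]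
    by (simp add: frechet_derivative_eqI)
qed

lemma hyperbolic_point_T_neg:
  assumes "hyperbolic_point h p" "T p p v = 0" "v \<noteq> 0"
  shows "T p v v < 0"
proof -
  have "has_signature (\<lambda>v w. - (6 * T p v w)) (CARD('m) - 1) 1" and "T p p p > 0"
    using assms(1) unfolding hyperbolic_point_def hessian_form_eq by (auto simp: h_eq)
  from has_signature_one_negative[OF this(1), of p v] this(2) assms
  show ?thesis by simp
qed

lemma hyperbolic_point_gram_le:
  assumes "hyperbolic_point h q"
  shows "T q q q * T q y y \<le> (T q q y)\<^sup>2"
proof -
  have q: "T q q q > 0" using assms unfolding hyperbolic_point_def by (simp add: h_eq)
  define y' where "y' = y - (T q q y / T q q q) *\<^sub>R q"
  have "T q q y' = 0" using q by (simp add: y'_def trilin_linear)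
  then have "T q y' y' \<le> 0"
    using hyperbolic_point_T_neg[OF assms, of y'] by (cases "y' = 0") (auto simp: trilin_def)
  moreover have "T q y' y' = T q y y - (T q q y)\<^sup>2 / T q q q"
    using q T_swap23[of q y q] by (simp add: y'_def trilin_linear power2_eq_square field_simps)
  ultimately have "T q y y \<le> (T q q y)\<^sup>2 / T q q q" by simp
  then show ?thesis using q by (simp add: pos_le_divide_eq mult.commute)
qed

text \<open>With \<open>c = T(y, y, y)\<close>, the Gram determinant of \<open>p, y\<close> for \<open>T(p + s y, _, _)\<close> is
  \<open>c s - 1/2 - s\<^sup>2/4\<close>. Hyperbolicity makes it nonpositive, and it is largest at \<open>s = 2 c\<close>.\<close>

lemma ccpsr_cubic_le:
  assumes H: "ccpsr_manifold h H" "p \<in> H"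
    and y: "T p p y = 0" "T p y y = - 1 / 2" and c: "T y y y > 0"
  shows "(T y y y)\<^sup>2 \<le> 1 / 2"
proof (rule ccontr)
  define c where "c = T y y y"
  assume "\<not> ?thesis"
  then have c2: "c\<^sup>2 > 1 / 2" and c0: "c > 0" using c by (auto simp: c_def)
  have lev: "H \<subseteq> {x. h x = 1}" and opn: "openin (top_of_set {x. h x = 1}) H"
    and cl: "closed H" and hyp: "\<And>q. q \<in> H \<Longrightarrow> hyperbolic_point h q"
    using H(1) openin_imp_subset unfolding ccpsr_manifold_def by auto
  have p1: "T p p p = 1" using H(2) lev h_eq by auto
  have perm: "T p y p = 0" "T y p p = 0" "T y p y = - 1 / 2" "T y y p = - 1 / 2"
    using y T_swap23[of p y p] T_rotate[of y p p] T_swap12[of y p y] T_rotate[of y y p] by auto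
  have hp: "h (p + s *\<^sub>R y) = 1 - 3 / 2 * s\<^sup>2 + c * s ^ 3" for s
    unfolding h_eq using p1 perm y
    by (simp add: trilin_linear c_def[symmetric] algebra_simps power2_eq_square power3_eq_cube)
  have pos: "h (p + s *\<^sub>R y) > 0" if "s \<ge> 0" for s
  proof -
    have "c\<^sup>2 * h (p + s *\<^sub>R y) = (c\<^sup>2 - 1 / 2) + (c * s - 1)\<^sup>2 * (c * s + 1 / 2)"
      unfolding hp by (simp add: algebra_simps power2_eq_square power3_eq_cube)
    moreover have "(c * s - 1)\<^sup>2 * (c * s + 1 / 2) \<ge> 0" using that c0 by simp
    ultimately have "c\<^sup>2 * h (p + s *\<^sub>R y) > 0" using c2 by linarith
    then show ?thesis using c0 by (simp add: zero_less_mult_iff)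
  qed
  define q where "q s = (1 / root 3 (h (p + s *\<^sub>R y))) *\<^sub>R (p + s *\<^sub>R y)" for s
  have q1: "h (q s) = 1" if "s \<ge> 0" for s
  proof -
    have "h (q s) = (1 / root 3 (h (p + s *\<^sub>R y))) ^ 3 * h (p + s *\<^sub>R y)"
      unfolding q_def h_eq[of "_ *\<^sub>R _"] by (simp add: trilin_linear(7-9) h_eq power3_eq_cube)
    then show ?thesis using pos[OF that] by (simp add: power_divide)
  qed
  let ?S = "q ` {0..2 * c}"
  have "continuous_on {0..2 * c} q"
    unfolding q_def hp using pos unfolding hp
    by (intro continuous_intros) (auto simp: less_imp_neq[symmetric] dest!: order_less_imp_not_eq2)
  then have conn: "connected ?S" by (intro connected_continuous_image connected_Icc)
  have S: "?S \<subseteq> {x. h x = 1}" using q1 by auto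
  obtain V where V: "open V" "H = {x. h x = 1} \<inter> V" using opn unfolding openin_open by blast
  then have "?S \<inter> H = ?S \<inter> V" using S by blast
  then have "openin (top_of_set ?S) (?S \<inter> H)" using V(1) by (simp add: openin_open_Int)
  moreover have "closedin (top_of_set ?S) (?S \<inter> H)"
    using cl by (simp add: closedin_closed_Int)
  moreover have "q 0 = p" unfolding q_def using hp[of 0] by simp
  then have "p \<in> ?S \<inter> H" using H(2) c0 by (force intro!: image_eqI[of _ _ 0])
  ultimately have "?S \<inter> H = ?S" using conn[unfolded connected_clopen] by blast
  then have "q (2 * c) \<in> H" using c0 by auto
  then have gram: "T (q (2 * c)) (q (2 * c)) (q (2 * c)) * T (q (2 * c)) y y \<le> (T (q (2 * c)) (q (2 * c)) y)\<^sup>2"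
    using hyp hyperbolic_point_gram_le by blast
  define r where "r = 1 / root 3 (h (p + (2 * c) *\<^sub>R y))"
  define w where "w = p + (2 * c) *\<^sub>R y"
  have r: "r > 0" using pos[of "2 * c"] c0 by (simp add: r_def)
  have qw: "q (2 * c) = r *\<^sub>R w" by (simp add: q_def r_def w_def)
  have "r ^ 4 * (T w w w * T w y y) \<le> r ^ 4 * (T w w y)\<^sup>2"
    using gram unfolding qw
    by (simp add: trilin_linear(7-9) power2_eq_square power4_eq_xxxx mult_ac)
  then have "T w w w * T w y y \<le> (T w w y)\<^sup>2" using r by simp
  moreover have "T w w w = 1 - 6 * c\<^sup>2 + 8 * c ^ 4" "T w y y = - 1 / 2 + 2 * c\<^sup>2" "T w w y = - 2 * c + 4 * c ^ 3"
    unfolding w_def using p1 perm y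
    by (simp_all add: trilin_linear c_def[symmetric] algebra_simps power2_eq_square power3_eq_cube power4_eq_xxxx)
  ultimately have "(1 - 6 * c\<^sup>2 + 8 * c ^ 4) * (- 1 / 2 + 2 * c\<^sup>2) \<le> (- 2 * c + 4 * c ^ 3)\<^sup>2" by simp
  then have "c\<^sup>2 - 1 / 2 \<le> 0" by (simp add: algebra_simps power2_eq_square power3_eq_cube power4_eq_xxxx)
  then show False using c2 by simp
qed

lemma ccpsr_cubic_bound:
  assumes H: "ccpsr_manifold h H" "p \<in> H" and y: "T p p y = 0"
  shows "(T y y y)\<^sup>2 \<le> (- 2 * T p y y) ^ 3 / 2"
proof (cases "y = 0")
  case True
  then show ?thesis by (simp add: trilin_def)
next
  case False
  have "hyperbolic_point h p" using H unfolding ccpsr_manifold_def by blast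
  from hyperbolic_point_T_neg[OF this y False] have neg: "T p y y < 0" .
  define s where "s = 1 / sqrt (- 2 * T p y y)"
  define z where "z = s *\<^sub>R y"
  have s: "s > 0" "s\<^sup>2 = 1 / (- 2 * T p y y)" using neg by (auto simp: s_def power_divide)
  have z: "T p p z = 0" "T p z z = - 1 / 2" "T z z z = s ^ 3 * T y y y"
    using y s neg by (simp_all add: z_def trilin_linear power3_eq_cube)
      (simp add: field_simps power2_eq_square)
  have "(T z z z)\<^sup>2 \<le> 1 / 2"
  proof (cases "T z z z" "0 :: real" rule: linorder_cases)
    case less
    have "(T (- z) (- z) (- z))\<^sup>2 \<le> 1 / 2"
      using less z by (intro ccpsr_cubic_le[OF H]) (simp_all add: trilin_linear)
    then show ?thesis by (simp add: trilin_linear)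
  next
    case greater
    then show ?thesis using z by (intro ccpsr_cubic_le[OF H])
  qed simp
  then have "(s\<^sup>2) ^ 3 * (T y y y)\<^sup>2 \<le> 1 / 2"
    unfolding z by (simp add: power_mult_distrib power_mult[symmetric])
  then show ?thesis unfolding s(2) using neg by (simp add: power_divide divide_simps) 
qed

lemma ccpsr_trilinear_unit_bound:
  assumes H: "ccpsr_manifold h H" "p \<in> H"
    and tan: "T p p x = 0" "T p p y = 0" "T p p z = 0"
    and unit: "- 2 * T p x x = 1" "- 2 * T p y y = 1" "- 2 * T p z z = 1"
  shows "\<bar>T x y z\<bar> \<le> 4"
proof -
  have hyp: "hyperbolic_point h p" using H unfolding ccpsr_manifold_def by blast
  have nn: "- 2 * T p v v \<ge> 0" if "T p p v = 0" for v
    using hyperbolic_point_T_neg[OF hyp that] by (cases "v = 0") (auto simp: trilin_def)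
  have cs: "\<bar>- 2 * T p v w\<bar> \<le> 1" if "T p p v = 0" "T p p w = 0" "- 2 * T p v v = 1" "- 2 * T p w w = 1" for v w
    using nn[of "v - w"] nn[of "v + w"] that T_swap23[of p v w] by (simp add: trilin_linear)
  have b: "\<bar>T w w w\<bar> \<le> 20" if "T p p w = 0" "- 2 * T p w w \<le> 9" for w
  proof -
    have "(T w w w)\<^sup>2 \<le> (- 2 * T p w w) ^ 3 / 2" using ccpsr_cubic_bound[OF H that(1)] .
    also have "\<dots> \<le> 9 ^ 3 / 2" using power_mono[OF that(2) nn[OF that(1)], of 3] by simp
    also have "\<dots> \<le> 20\<^sup>2" by simp
    finally show ?thesis using abs_le_square_iff[of "T w w w" 20] by simp
  qed
  note cs' = cs[OF tan(1,2) unit(1,2)] cs[OF tan(1,3) unit(1,3)] cs[OF tan(2,3) unit(2,3)]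
  have "\<bar>T (x + y + z) (x + y + z) (x + y + z)\<bar> \<le> 20" "\<bar>T (x + y - z) (x + y - z) (x + y - z)\<bar> \<le> 20"
    "\<bar>T (x - y + z) (x - y + z) (x - y + z)\<bar> \<le> 20" "\<bar>T (x - y - z) (x - y - z) (x - y - z)\<bar> \<le> 20"
    by (rule b; insert cs' tan unit T_swap23[of p y x] T_swap23[of p z x] T_swap23[of p z y];
        simp add: trilin_linear abs_le_iff)+
  moreover have "24 * T x y z = T (x + y + z) (x + y + z) (x + y + z) - T (x + y - z) (x + y - z) (x + y - z)
     - T (x - y + z) (x - y + z) (x - y + z) + T (x - y - z) (x - y - z) (x - y - z)"
    using T_swap23[of x z y] T_swap12[of y x z] T_rotate[of y z x] T_rotate[of z x y] T_rotate[of z y x]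
    by (simp add: trilin_linear)
  ultimately show ?thesis by (simp add: abs_le_iff)
qed

lemma ccpsr_trilinear_bound:
  assumes H: "ccpsr_manifold h H" "p \<in> H"
    and tan: "T p p x = 0" "T p p y = 0" "T p p z = 0"
  shows "\<bar>T x y z\<bar> \<le> 4 * sqrt (- 2 * T p x x) * sqrt (- 2 * T p y y) * sqrt (- 2 * T p z z)"
proof (cases "x = 0 \<or> y = 0 \<or> z = 0")
  case True
  then show ?thesis by (auto simp: trilin_def)
next
  case False
  have hyp: "hyperbolic_point h p" using H unfolding ccpsr_manifold_def by blast
  define N where "N v = sqrt (- 2 * T p v v)" for v
  define u where "u v = (1 / N v) *\<^sub>R v" for v
  have N: "N v > 0" if "T p p v = 0" "v \<noteq> 0" for v
    using hyperbolic_point_T_neg[OF hyp that] by (simp add: N_def)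
  have u: "T p p (u v) = 0" "- 2 * T p (u v) (u v) = 1" if "T p p v = 0" "v \<noteq> 0" for v
  proof -
    have "(N v)\<^sup>2 = - 2 * T p v v" using N[OF that] by (simp add: N_def)
    then show "- 2 * T p (u v) (u v) = 1" "T p p (u v) = 0" using N[OF that] that hyperbolic_point_T_neg[OF hyp that]
      by (simp_all add: u_def trilin_linear power2_eq_square)
  qed
  have "\<bar>T (u x) (u y) (u z)\<bar> \<le> 4"
    using False u tan by (intro ccpsr_trilinear_unit_bound[OF H]) auto
  then show ?thesis unfolding N_def[symmetric]
    using False N[OF tan(1)] N[OF tan(2)] N[OF tan(3)]
    by (simp add: u_def trilin_linear abs_mult field_simps)
qed

end

lemma homogeneous_cubic_polarisation:
  assumes "homogeneous_cubic h"
  obtains t where "cubic_form h t"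
proof -
  obtain c where c: "\<And>x. h x = trilin c x x x"
    using assms unfolding homogeneous_cubic_def trilin_def by blast
  define t where "t i j k = (1 / 6) * (c i j k + c i k j + c j i k + c j k i + c k i j + c k j i)" for i j k
  have sw: "trilin (\<lambda>i j k. a j i k) x x x = trilin a x x x"
    "trilin (\<lambda>i j k. a i k j) x x x = trilin a x x x" for a :: "'a \<Rightarrow> 'a \<Rightarrow> 'a \<Rightarrow> real" and x
    using trilin_swap12[of a x x x] trilin_swap23[of a x x x] by simp_all
  have "trilin t x x x = trilin c x x x" for x
    unfolding t_def trilin_coeff_linear
    using sw(1)[of c x] sw(2)[of c x] sw(1)[of "\<lambda>i j k. c i k j" x] sw(2)[of "\<lambda>i j k. c j i k" x]
      sw(1)[of "\<lambda>i j k. c k i j" x]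
    by simp
  then have "cubic_form h t" by unfold_locales (simp_all add: c t_def)
  then show ?thesis using that by blast
qed

subsection \<open>The Gauss equation\<close>

lemma partial_deriv_trilin:
  fixes f g k :: "real ^ 'n \<Rightarrow> real ^ 'm"
  assumes "f differentiable (at x)" "g differentiable (at x)" "k differentiable (at x)"
  shows "partial_deriv i (\<lambda>y. trilin t (f y) (g y) (k y)) x =
    trilin t (frechet_derivative f (at x) (axis i 1)) (g x) (k x)
    + trilin t (f x) (frechet_derivative g (at x) (axis i 1)) (k x)
    + trilin t (f x) (g x) (frechet_derivative k (at x) (axis i 1))"
  using assms[unfolded frechet_derivative_works] by (intro partial_deriv_eqI has_derivative_trilin)

lemma differentiable_trilin:
  assumes "f differentiable (at x)" "g differentiable (at x)" "k differentiable (at x)"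
  shows "(\<lambda>y. trilin t (f y) (g y) (k y)) differentiable (at x)"
  using has_derivative_trilin[OF assms[unfolded frechet_derivative_works]]
  unfolding differentiable_def by blast

lemma partial_deriv_cmult:
  assumes "f differentiable (at x)"
  shows "partial_deriv i (\<lambda>y. c * f y) x = c * partial_deriv i f x"
  using partial_deriv_mult[OF differentiable_const assms, of i c] by (simp add: partial_deriv_def)

lemma partial_deriv_cmult_trilin:
  fixes f g k :: "real ^ 'n \<Rightarrow> real ^ 'm"
  assumes "f differentiable (at x)" "g differentiable (at x)" "k differentiable (at x)"
  shows "partial_deriv i (\<lambda>y. c * trilin t (f y) (g y) (k y)) x =
    c * (trilin t (frechet_derivative f (at x) (axis i 1)) (g x) (k x)
    + trilin t (f x) (frechet_derivative g (at x) (axis i 1)) (k x)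
    + trilin t (f x) (g x) (frechet_derivative k (at x) (axis i 1)))"
  by (simp only: partial_deriv_cmult[OF differentiable_trilin[OF assms]] partial_deriv_trilin[OF assms])

lemma partial_deriv_add:
  assumes "f differentiable (at x)" "g differentiable (at x)"
  shows "partial_deriv i (\<lambda>y. f y + g y) x = partial_deriv i f x + partial_deriv i g x"
  unfolding partial_deriv_def
  by (subst frechet_derivative_eqI[OF has_derivative_add[OF assms[unfolded frechet_derivative_works]]]) simp

lemma linear_axis_expansion:
  assumes "linear f"
  shows "f v = (\<Sum>i\<in>UNIV. (v::real^'k::finite) $ i *\<^sub>R f (axis i 1))"
  using linear_sum[OF assms, of "\<lambda>i. v $ i *\<^sub>R axis i 1" UNIV] basis_expansion[of v]
  by (simp add: linear_cmul[OF assms] scalar_mult_eq_scaleR)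

locale ccpsr_chart = cubic_form h t
  for h :: "real ^ 'm::finite \<Rightarrow> real" and t +
  fixes H :: "(real ^ 'm) set" and U :: "(real ^ 'n::finite) set" and \<phi> :: "real ^ 'n \<Rightarrow> real ^ 'm"
  assumes ccpsr: "ccpsr_manifold h H" and chart: "local_parametrization H U \<phi>"
    and card: "CARD('m) = CARD('n) + 1"
begin

definition E :: "'n \<Rightarrow> real ^ 'n \<Rightarrow> real ^ 'm" where
  "E i x = frechet_derivative \<phi> (at x) (axis i 1)"

definition F :: "'n \<Rightarrow> 'n \<Rightarrow> real ^ 'n \<Rightarrow> real ^ 'm" where
  "F i j x = frechet_derivative (E i) (at x) (axis j 1)"

definition D :: "'n \<Rightarrow> 'n \<Rightarrow> 'n \<Rightarrow> real ^ 'n \<Rightarrow> real ^ 'm" where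
  "D i j k x = frechet_derivative (F i j) (at x) (axis k 1)"

abbreviation g :: "real ^ 'n \<Rightarrow> real ^ 'n ^ 'n" where "g \<equiv> metric_coords h \<phi>"

lemma open_U: "open U" and smooth_phi: "smooth_on U \<phi>"
  using chart unfolding local_parametrization_def by auto

lemma smooth_E: "smooth_on U (E i)"
  using smooth_on_frechet_derivative[OF smooth_phi] unfolding E_def[abs_def] .

lemma smooth_F: "smooth_on U (F i j)"
  using smooth_on_frechet_derivative[OF smooth_E] unfolding F_def[abs_def] .

lemmas differentiable_phi = smooth_on_differentiable[OF smooth_phi]
lemmas differentiable_E = smooth_on_differentiable[OF smooth_E]
lemmas differentiable_F = smooth_on_differentiable[OF smooth_F]

lemma phi_in_H: assumes "x \<in> U" shows "\<phi> x \<in> H"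
proof -
  from chart have "openin (top_of_set H) (\<phi> ` U)" by (simp add: local_parametrization_def)
  from openin_imp_subset[OF this] show ?thesis using assms by blast
qed

lemma F_sym: "x \<in> U \<Longrightarrow> F i j x = F j i x"
  unfolding F_def E_def using second_derivative_symmetric[OF open_U _ smooth_phi] .

lemma D_sym: assumes "x \<in> U" shows "D j k i x = D i k j x"
proof -
  have 1: "D i j k x = D j i k x" for i j k
    unfolding D_def by (simp only: frechet_derivative_cong_open[OF open_U assms, of "F i j" "F j i", OF F_sym])
  have 2: "D i j k x = D i k j x" for i j k
    unfolding D_def F_def using second_derivative_symmetric[OF open_U assms smooth_E] .
  show ?thesis using 1[of j k i] 2[of k j i] 1[of k i j] by simp
qed

lemma T_phi: assumes "x \<in> U" shows "T (\<phi> x) (\<phi> x) (\<phi> x) = 1"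
proof -
  have "H \<subseteq> {x. h x = 1}" using ccpsr openin_imp_subset unfolding ccpsr_manifold_def by blast
  then have "h (\<phi> x) = 1" using phi_in_H[OF assms] by blast
  then show ?thesis by (simp only: h_eq)
qed

lemma T_phi_E: assumes "x \<in> U" shows "T (\<phi> x) (\<phi> x) (E i x) = 0"
proof -
  have "partial_deriv i (\<lambda>y. T (\<phi> y) (\<phi> y) (\<phi> y)) x = partial_deriv i (\<lambda>y. 1) x"
    by (rule partial_deriv_cong_open[OF open_U assms T_phi])
  also have "\<dots> = 0" by (simp add: partial_deriv_def)
  finally show ?thesis
    unfolding partial_deriv_trilin[OF differentiable_phi[OF assms] differentiable_phi[OF assms] differentiable_phi[OF assms]]
      E_def[symmetric]
    using T_rotate[of "E i x" "\<phi> x" "\<phi> x"] T_swap23[of "\<phi> x" "\<phi> x" "E i x"] by simp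
qed

lemma g_eq: "g x $ i $ j = - 2 * T (\<phi> x) (E i x) (E j x)"
  by (simp add: metric_coords_def centro_affine_form_def hessian_form_eq E_def)

lemma g_eq': "(\<lambda>y. g y $ i $ j) = (\<lambda>y. - 2 * T (\<phi> y) (E i y) (E j y))"
  by (rule ext) (rule g_eq)

lemma g_sym: "g x $ i $ j = g x $ j $ i"
  unfolding g_eq by (simp only: T_swap23[of "\<phi> x" "E i x" "E j x"])

lemma T_phi_F: assumes "x \<in> U" shows "T (\<phi> x) (\<phi> x) (F i j x) = g x $ i $ j"
proof -
  have "partial_deriv j (\<lambda>y. T (\<phi> y) (\<phi> y) (E i y)) x = partial_deriv j (\<lambda>y. 0) x"
    by (rule partial_deriv_cong_open[OF open_U assms T_phi_E])
  also have "\<dots> = 0" by (simp add: partial_deriv_def)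
  finally show ?thesis
    unfolding partial_deriv_trilin[OF differentiable_phi[OF assms] differentiable_phi[OF assms] differentiable_E[OF assms]]
      E_def[symmetric] F_def[symmetric] g_eq
    using T_swap12[of "E j x" "\<phi> x" "E i x"] T_swap23[of "\<phi> x" "E i x" "E j x"] by simp
qed

lemma differentiable_g: "x \<in> U \<Longrightarrow> (\<lambda>y. g y $ i $ j) differentiable (at x)"
  unfolding g_eq'
  by (intro differentiable_mult differentiable_const differentiable_trilin differentiable_phi differentiable_E)

lemma partial_deriv_g:
  assumes "x \<in> U"
  shows "partial_deriv k (\<lambda>y. g y $ i $ j) x =
    - 2 * (T (E k x) (E i x) (E j x) + T (\<phi> x) (F i k x) (E j x) + T (\<phi> x) (E i x) (F j k x))"
  unfolding g_eq' E_def[symmetric] F_def[symmetric]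
    partial_deriv_cmult_trilin[OF differentiable_phi[OF assms] differentiable_E[OF assms] differentiable_E[OF assms]] ..

lemma differentiable_partial_deriv_g:
  assumes "x \<in> U"
  shows "partial_deriv k (\<lambda>y. g y $ i $ j) differentiable (at x)"
proof (rule differentiable_cong_open[OF open_U assms partial_deriv_g[symmetric]])
  show "(\<lambda>x. - 2 * (T (E k x) (E i x) (E j x) + T (\<phi> x) (F i k x) (E j x) + T (\<phi> x) (E i x) (F j k x)))
      differentiable (at x)"
    using assms
    by (intro differentiable_mult differentiable_add differentiable_const differentiable_trilin
        differentiable_phi differentiable_E differentiable_F)
qed

lemma christoffel_lower_g:
  assumes "x \<in> U"
  shows "christoffel_lower g m i j x = - T (E i x) (E j x) (E m x) - 2 * T (\<phi> x) (F i j x) (E m x)"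
  unfolding christoffel_lower_def partial_deriv_g[OF assms]
  using F_sym[OF assms, of j i] F_sym[OF assms, of m i] F_sym[OF assms, of m j]
    T_swap12[of "E j x" "E i x" "E m x"] T_rotate(1)[of "E m x" "E i x" "E j x"]
    T_swap23[of "\<phi> x" "E j x" "F i m x"]
  by simp

definition L :: "real ^ 'n \<Rightarrow> real ^ 'n \<Rightarrow> real ^ 'm" where
  "L x v = frechet_derivative \<phi> (at x) v"

definition M :: "real ^ 'n \<Rightarrow> real ^ 'n \<Rightarrow> real ^ 'n \<Rightarrow> real" where
  "M x v w = - 2 * T (\<phi> x) (L x v) (L x w)"

lemma linear_L: "x \<in> U \<Longrightarrow> linear (L x)"
  unfolding L_def[abs_def]
  by (rule has_derivative_linear[OF differentiable_phi[unfolded frechet_derivative_works]])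

lemma inj_L: "x \<in> U \<Longrightarrow> inj (L x)"
  using chart by (simp add: L_def[abs_def] local_parametrization_def)

lemma L_axis: "L x (axis i 1) = E i x"
  by (simp add: L_def E_def)

lemma T_phi_L: assumes "x \<in> U" shows "T (\<phi> x) (\<phi> x) (L x v) = 0"
proof -
  have "linear (\<lambda>v. T (\<phi> x) (\<phi> x) (L x v))"
    using linear_L[OF assms] by (intro linearI) (simp_all add: linear_add linear_cmul trilin_linear)
  from linear_axis_expansion[OF this, of v] show ?thesis by (simp add: L_axis T_phi_E[OF assms])
qed

lemma M_linear:
  assumes "x \<in> U"
  shows "M x (v + v') w = M x v w + M x v' w" "M x v (w + w') = M x v w + M x v w'"
    "M x (a *\<^sub>R v) w = a * M x v w" "M x v (a *\<^sub>R w) = a * M x v w"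
  using linear_L[OF assms] by (simp_all add: M_def linear_add linear_cmul trilin_linear)

lemma M_sym: "M x v w = M x w v"
  unfolding M_def by (simp only: T_swap23[of "\<phi> x" "L x v" "L x w"])

lemma M_axis: "M x (axis i 1) (axis j 1) = g x $ i $ j"
  by (simp add: M_def g_eq L_axis)

lemma M_eq: assumes "x \<in> U" shows "M x v w = v \<bullet> (g x *v w)"
proof -
  have l1: "linear (\<lambda>v. M x v w)" for w using M_linear[OF assms] by (intro linearI) auto
  have l2: "linear (\<lambda>w. M x v w)" for v using M_linear[OF assms] by (intro linearI) auto
  have "M x v w = (\<Sum>i\<in>UNIV. v $ i *\<^sub>R M x (axis i 1) w)"
    by (rule linear_axis_expansion[OF l1])
  also have "\<dots> = (\<Sum>i\<in>UNIV. v $ i *\<^sub>R (\<Sum>j\<in>UNIV. w $ j *\<^sub>R g x $ i $ j))"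
    by (simp only: linear_axis_expansion[OF l2, of _ w] M_axis)
  finally have "M x v w = (\<Sum>i\<in>UNIV. v $ i *\<^sub>R (\<Sum>j\<in>UNIV. w $ j *\<^sub>R g x $ i $ j))" .
  then show ?thesis
    by (simp add: inner_vec_def matrix_vector_mult_def mult.commute)
qed

lemma M_pos: assumes "x \<in> U" "v \<noteq> 0" shows "M x v v > 0"
proof -
  have "hyperbolic_point h (\<phi> x)"
    using ccpsr phi_in_H[OF assms(1)] unfolding ccpsr_manifold_def by blast
  moreover have "L x v \<noteq> 0"
    using inj_L[OF assms(1)] linear_L[OF assms(1)] assms(2) linear_injective_0 by blast
  ultimately show ?thesis
    using hyperbolic_point_T_neg T_phi_L[OF assms(1)] unfolding M_def by fastforce
qed

lemma invertible_g: assumes "x \<in> U" shows "invertible (g x)"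
proof -
  have "v = 0" if "g x *v v = 0" for v
    using M_pos[OF assms, of v] that by (auto simp: M_eq[OF assms])
  then show ?thesis
    unfolding invertible_left_inverse matrix_left_invertible_ker by blast
qed

lemma tangent_in_range:
  assumes x: "x \<in> U" and z: "T (\<phi> x) (\<phi> x) z = 0"
  shows "\<exists>a. z = L x a"
proof -
  let ?S = "{z. T (\<phi> x) (\<phi> x) z = 0}"
  have S: "subspace ?S" unfolding subspace_def by (auto simp: trilin_linear) (simp add: trilin_def)
  have "\<phi> x \<notin> ?S" using T_phi[OF x] by simp
  then have "?S \<noteq> UNIV" by blast
  then have "dim ?S < CARD('m)"
    using dim_eq_full[of ?S] S dim_subset_UNIV[of ?S] by (simp add: span_eq_iff[THEN iffD2] le_neq_implies_less)
  moreover have "dim (range (L x)) = CARD('n)"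
    using dim_image_eq[OF linear_L[OF x], of UNIV] inj_L[OF x] by simp
  moreover have "range (L x) \<subseteq> ?S" using T_phi_L[OF x] by auto
  moreover have "subspace (range (L x))" using linear_subspace_image[OF linear_L[OF x] subspace_UNIV] .
  ultimately have "range (L x) = ?S" using S card by (intro subspace_dim_equal) auto
  then show ?thesis using z by auto
qed

definition K :: "real ^ 'n \<Rightarrow> real ^ 'n \<Rightarrow> real ^ 'n \<Rightarrow> real ^ 'n" where
  "K x v w = matrix_inv (g x) *v (\<chi> m. - T (L x v) (L x w) (E m x))"

lemma g_K: "x \<in> U \<Longrightarrow> g x *v K x v w = (\<chi> m. - T (L x v) (L x w) (E m x))"
  unfolding K_def by (simp add: matrix_vector_mul_assoc matrix_inv_inverse[OF invertible_g])

lemma M_K: assumes "x \<in> U" shows "M x z (K x v w) = - T (L x v) (L x w) (L x z)"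
proof -
  have "linear (\<lambda>z. T (L x v) (L x w) (L x z))"
    using linear_L[OF assms] by (intro linearI) (simp_all add: linear_add linear_cmul trilin_linear)
  from linear_axis_expansion[OF this, of z] show ?thesis
    unfolding M_eq[OF assms] g_K[OF assms] by (simp add: inner_vec_def L_axis sum_negf)
qed

lemma K_sym: "K x v w = K x w v"
  unfolding K_def by (simp only: T_swap12[of "L x v" "L x w"])

lemma K_linear:
  assumes "x \<in> U"
  shows "K x (v + v') w = K x v w + K x v' w" "K x (a *\<^sub>R v) w = a *\<^sub>R K x v w"
proof -
  have "(\<chi> m. - T (L x (v + v')) (L x w) (E m x)) = (\<chi> m. - T (L x v) (L x w) (E m x)) + (\<chi> m. - T (L x v') (L x w) (E m x))"
    using linear_L[OF assms] by (simp add: vec_eq_iff linear_add trilin_linear)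
  then show "K x (v + v') w = K x v w + K x v' w" unfolding K_def by (simp add: matrix_vector_right_distrib)
  have "(\<chi> m. - T (L x (a *\<^sub>R v)) (L x w) (E m x)) = a *\<^sub>R (\<chi> m. - T (L x v) (L x w) (E m x))"
    using linear_L[OF assms] by (simp add: vec_eq_iff linear_cmul trilin_linear)
  then show "K x (a *\<^sub>R v) w = a *\<^sub>R K x v w" unfolding K_def by (simp add: matrix_vector_mult_scaleR)
qed

definition Q :: "real ^ 'n \<Rightarrow> real ^ 'n \<Rightarrow> real ^ 'n \<Rightarrow> real ^ 'n \<Rightarrow> real ^ 'n \<Rightarrow> real" where
  "Q x a b c d = M x a c * M x b d - M x b c * M x a d
     + M x (K x a c) (K x b d) - M x (K x b c) (K x a d)"

lemma lower_riemann_g: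
  assumes x: "x \<in> U"
  shows "(\<Sum>l\<in>UNIV. g x $ m $ l * riemann g l k i j x) = Q x (axis i 1) (axis j 1) (axis k 1) (axis m 1)"
proof -
  have "\<exists>a. \<forall>i j. F i j x = g x $ i $ j *\<^sub>R \<phi> x + L x (a i j)"
  proof -
    have "\<exists>a. F i j x = g x $ i $ j *\<^sub>R \<phi> x + L x a" for i j
      using tangent_in_range[OF x, of "F i j x - g x $ i $ j *\<^sub>R \<phi> x"] T_phi_F[OF x] T_phi[OF x]
      by (auto simp: trilin_linear algebra_simps)
    then show ?thesis by metis
  qed
  then obtain a where F: "\<And>i j. F i j x = g x $ i $ j *\<^sub>R \<phi> x + L x (a i j)" by blast
  define A where "A i j k m = T (L x (a i j)) (E k x) (E m x)" for i j k m
  define C where "C i j k m = M x (a i j) (a k m)" for i j k m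
  have TF: "T (F i j x) (E k x) (E m x) = - g x $ i $ j * g x $ k $ m / 2 + A i j k m" for i j k m
    by (simp add: F trilin_linear A_def g_eq[of x k m])
  have TFF: "T (\<phi> x) (F i j x) (F k m x) = g x $ i $ j * g x $ k $ m - C i j k m / 2" for i j k m
    using T_phi[OF x] T_phi_L[OF x] T_swap23[of "\<phi> x" "L x (a i j)" "\<phi> x"]
    by (simp add: F trilin_linear C_def M_def)
  have a_sym: "A i j k m = A j i k m" for i j k m
    using TF[of i j k m] TF[of j i k m] F_sym[OF x, of i j] g_sym[of x i j] by simp
  have a_sym': "C i j k m = C i j m k" for i j k m
    using TFF[of i j k m] TFF[of i j m k] F_sym[OF x, of k m] g_sym[of x k m] by simp
  have dl: "partial_deriv i (christoffel_lower g m j k) x =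
     g x $ i $ j * g x $ k $ m / 2 - A i j k m + g x $ i $ k * g x $ j $ m / 2 - A i k j m
     + g x $ i $ m * g x $ j $ k / 2 - A i m j k - g x $ j $ k * g x $ i $ m - 2 * A j k i m
     - 2 * T (\<phi> x) (D j k i x) (E m x) + C j k i m" for i j k m
  proof -
    have d1: "(\<lambda>y. (- 1) * T (E j y) (E k y) (E m y)) differentiable (at x)"
      by (intro differentiable_mult differentiable_const differentiable_trilin differentiable_E x)
    have d2: "(\<lambda>y. (- 2) * T (\<phi> y) (F j k y) (E m y)) differentiable (at x)"
      by (intro differentiable_mult differentiable_const differentiable_trilin differentiable_phi
          differentiable_E differentiable_F x)
    have "partial_deriv i (christoffel_lower g m j k) x =
       partial_deriv i (\<lambda>y. (- 1) * T (E j y) (E k y) (E m y) + (- 2) * T (\<phi> y) (F j k y) (E m y)) x"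
      by (rule partial_deriv_cong_open[OF open_U x]) (simp add: christoffel_lower_g)
    also have "\<dots> = (- 1) * (T (F j i x) (E k x) (E m x) + T (E j x) (F k i x) (E m x) + T (E j x) (E k x) (F m i x))
      + (- 2) * (T (E i x) (F j k x) (E m x) + T (\<phi> x) (D j k i x) (E m x) + T (\<phi> x) (F j k x) (F m i x))"
      unfolding partial_deriv_add[OF d1 d2] E_def[symmetric] F_def[symmetric] D_def[symmetric]
        partial_deriv_cmult_trilin[OF differentiable_E[OF x] differentiable_E[OF x] differentiable_E[OF x]]
        partial_deriv_cmult_trilin[OF differentiable_phi[OF x] differentiable_F[OF x] differentiable_E[OF x]] ..
    also have "T (E j x) (F k i x) (E m x) = T (F k i x) (E j x) (E m x)" by (rule T_swap12)
    also have "T (E j x) (E k x) (F m i x) = T (F m i x) (E j x) (E k x)" by (rule T_rotate)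
    also have "T (E i x) (F j k x) (E m x) = T (F j k x) (E i x) (E m x)" by (rule T_swap12)
    finally show ?thesis
      unfolding TF TFF
      using a_sym[of j i k m] a_sym[of k i j m] a_sym[of m i j k] a_sym'[of j k m i]
        g_sym[of x j i] g_sym[of x k i] g_sym[of x m i]
      by (simp add: algebra_simps)
  qed
  define \<Gamma> where "\<Gamma> i j = (\<chi> q. christoffel g q i j x)" for i j
  have g\<Gamma>: "g x *v \<Gamma> i j = (\<chi> q. christoffel_lower g q i j x)" for i j
    by (simp add: \<Gamma>_def vec_eq_iff matrix_vector_mult_def lower_christoffel[where g=g, OF invertible_g[OF x]])
  have gK: "(g x *v K x (axis i 1) (axis j 1)) $ q = - T (E i x) (E j x) (E q x)" for i j q
    by (simp add: g_K[OF x] L_axis)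
  have ga: "(g x *v a i j) $ q = - 2 * T (\<phi> x) (F i j x) (E q x)" for i j q
  proof -
    have "(g x *v a i j) $ q = M x (axis q 1) (a i j)"
      by (simp add: M_eq[OF x] inner_axis')
    also have "\<dots> = - 2 * T (\<phi> x) (F i j x) (E q x)"
      using T_swap23[of "\<phi> x" "E q x" "L x (a i j)"] T_phi_E[OF x]
      by (simp add: M_def F trilin_linear L_axis)
    finally show ?thesis .
  qed
  have "g x *v \<Gamma> i j = g x *v (a i j + K x (axis i 1) (axis j 1))" for i j
    by (simp add: g\<Gamma> vec_eq_iff christoffel_lower_g[OF x] matrix_vector_right_distrib ga gK)
  then have "matrix_inv (g x) *v (g x *v \<Gamma> i j) = matrix_inv (g x) *v (g x *v (a i j + K x (axis i 1) (axis j 1)))" for i j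
    by simp
  then have \<Gamma>: "\<Gamma> i j = a i j + K x (axis i 1) (axis j 1)" for i j
    by (simp add: matrix_vector_mul_assoc matrix_inv_inverse[OF invertible_g[OF x]])
  have KA: "M x (a i j) (K x (axis k 1) (axis m 1)) = - A i j k m" for i j k m
    using T_rotate(2)[of "E k x" "E m x" "L x (a i j)"] by (simp add: M_K[OF x] L_axis A_def)
  have q: "(\<Sum>q\<in>UNIV. christoffel_lower g q i m x * christoffel g q j k x) =
     C j k i m - A j k i m - A i m j k + M x (K x (axis j 1) (axis k 1)) (K x (axis i 1) (axis m 1))" for i m j k
  proof -
    have "(\<Sum>q\<in>UNIV. christoffel_lower g q i m x * christoffel g q j k x) = \<Gamma> j k \<bullet> (g x *v \<Gamma> i m)"
      unfolding g\<Gamma> by (simp add: inner_vec_def \<Gamma>_def mult.commute)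
    also have "\<dots> = M x (\<Gamma> j k) (\<Gamma> i m)" by (simp add: M_eq[OF x])
    finally show ?thesis
      unfolding \<Gamma> M_linear[OF x] using M_sym[of x "K x (axis j 1) (axis k 1)" "a i m"] by (simp add: C_def KA)
  qed
  have "(\<Sum>l\<in>UNIV. g x $ m $ l * riemann g l k i j x) =
    partial_deriv i (christoffel_lower g m j k) x - partial_deriv j (christoffel_lower g m i k) x
    - (\<Sum>q\<in>UNIV. christoffel_lower g q i m x * christoffel g q j k x
                - christoffel_lower g q j m x * christoffel g q i k x)"
    by (rule lower_riemann[OF open_U x])
      (auto intro: invertible_g g_sym differentiable_g[OF x] differentiable_partial_deriv_g[OF x])
  then show ?thesis
    unfolding dl sum_subtractf q Q_def M_axis
    using D_sym[OF x, of j k i] a_sym[of i j k m] g_sym[of x i j]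
    by (simp add: algebra_simps)
qed

end

subsection \<open>Curvature bounds\<close>

lemma orthonormal_family_exists:
  fixes M :: "real ^ 'n::finite \<Rightarrow> real ^ 'n \<Rightarrow> real"
  assumes bil: "bilinear M" and sym: "\<And>v w. M v w = M w v" and pos: "\<And>v. v \<noteq> 0 \<Longrightarrow> M v v > 0"
  shows "\<exists>u :: 'n \<Rightarrow> real ^ 'n. \<forall>a b. M (u a) (u b) = (if a = b then 1 else 0)"
proof -
  have "\<exists>B. finite B \<and> card B = k \<and> (\<forall>a\<in>B. \<forall>b\<in>B. M a b = (if a = b then 1 else 0))"
    if "k \<le> CARD('n)" for k
    using that
  proof (induction k)
    case 0
    show ?case by (intro exI[of _ "{}"]) simp
  next
    case (Suc k)
    then obtain B where B: "finite B" "card B = k" "\<And>a b. a \<in> B \<Longrightarrow> b \<in> B \<Longrightarrow> M a b = (if a = b then 1 else 0)"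
      by auto
    have "dim (span B) < CARD('n)" using dim_le_card'[OF B(1)] B(2) Suc.prems by simp
    then have "span B \<noteq> UNIV" by (metis dim_UNIV DIM_cart DIM_real mult.right_neutral less_irrefl)
    then obtain v where v: "v \<notin> span B" by blast
    define w where "w = v - (\<Sum>b\<in>B. M v b *\<^sub>R b)"
    have "(\<Sum>b\<in>B. M v b *\<^sub>R b) \<in> span B" by (simp add: span_sum span_scale span_base)
    then have "w \<noteq> 0" using v by (auto simp: w_def)
    have lin: "linear (\<lambda>v. M v c)" for c using bil by (simp add: bilinear_def)
    have orth: "M w c = 0" if "c \<in> B" for c
    proof -
      have "M w c = M v c - (\<Sum>b\<in>B. M v b * M b c)"
        unfolding w_def linear_diff[OF lin] linear_sum[OF lin] linear_cmul[OF lin] by simp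
      also have "(\<Sum>b\<in>B. M v b * M b c) = (\<Sum>b\<in>B. if b = c then M v b else 0)"
        using that B(3) by (intro sum.cong) auto
      finally show ?thesis using that B(1) by simp
    qed
    define s where "s = 1 / sqrt (M w w)"
    have s: "s * s * M w w = 1"
      using pos[OF \<open>w \<noteq> 0\<close>] by (simp add: s_def)
    define e where "e = s *\<^sub>R w"
    have e: "M e e = 1" "\<And>c. c \<in> B \<Longrightarrow> M e c = 0"
      using s orth by (simp_all add: e_def bilinear_lmul[OF bil] bilinear_rmul[OF bil])
    then have e': "\<And>c. c \<in> B \<Longrightarrow> M c e = 0" by (subst sym) simp
    have "e \<notin> B" using e(1,2) by auto
    then show ?case
      using B e e' by (intro exI[of _ "insert e B"]) auto
  qed
  from this[OF order_refl] obtain B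
    where B: "finite B" "card B = CARD('n)" "\<And>a b. a \<in> B \<Longrightarrow> b \<in> B \<Longrightarrow> M a b = (if a = b then 1 else 0)"
    by blast
  obtain u where u: "bij_betw u (UNIV :: 'n set) B"
    using finite_same_card_bij[OF finite B(1)] B(2) by auto
  then have "M (u a) (u b) = (if a = b then 1 else 0)" for a b
    using B(3)[of "u a" "u b"] by (auto simp: bij_betw_def inj_on_def)
  then show ?thesis by blast
qed

lemma matrix_inv_orthonormal:
  fixes G :: "real ^ 'n ^ 'n" and u :: "'n \<Rightarrow> real ^ 'n"
  assumes u: "\<And>a b. u a \<bullet> (G *v u b) = (if a = b then 1 else 0)"
  shows "matrix_inv G $ i $ j = (\<Sum>a\<in>UNIV. u a $ i * u a $ j)"
proof -
  define A :: "real ^ 'n ^ 'n" where "A = (\<chi> i a. u a $ i)"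
  have "(transpose A ** (G ** A)) $ a $ b = u a \<bullet> (G *v u b)" for a b
    unfolding A_def by (simp add: matrix_matrix_mult_def matrix_vector_mult_def transpose_def inner_vec_def)
  then have "transpose A ** (G ** A) = mat 1" by (simp add: vec_eq_iff u mat_def)
  then have "(transpose A ** G) ** A = mat 1" by (simp add: matrix_mul_assoc)
  then have "A ** (transpose A ** G) = mat 1" by (rule matrix_left_right_inverse[THEN iffD1])
  then have 1: "(A ** transpose A) ** G = mat 1" by (simp add: matrix_mul_assoc)
  then have 2: "invertible G" by (auto simp: invertible_left_inverse)
  have "matrix_inv G = (A ** transpose A) ** (G ** matrix_inv G)"
    unfolding matrix_mul_assoc 1 by simp
  then have "matrix_inv G = A ** transpose A" by (simp add: matrix_inv_inverse[OF 2])
  then show ?thesis by (simp add: A_def matrix_matrix_mult_def transpose_def)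
qed

lemma bilinear_trace:
  fixes f :: "real ^ 'n::finite \<Rightarrow> real ^ 'n \<Rightarrow> real"
  assumes bil: "bilinear f" and c: "\<And>i j. c i j = (\<Sum>a\<in>UNIV. u a $ i * u a $ j)"
  shows "(\<Sum>i\<in>UNIV. \<Sum>j\<in>UNIV. c i j * f (axis i 1) (axis j 1)) = (\<Sum>a\<in>UNIV. f (u a) (u a))"
proof -
  have l: "linear (\<lambda>v. f v w)" "linear (\<lambda>w. f v w)" for v w using bil by (auto simp: bilinear_def)
  have "f v v = (\<Sum>i\<in>UNIV. v $ i *\<^sub>R f (axis i 1) v)" for v
    by (rule linear_axis_expansion[OF l(1)])
  also have "\<dots> v = (\<Sum>i\<in>UNIV. v $ i *\<^sub>R (\<Sum>j\<in>UNIV. v $ j *\<^sub>R f (axis i 1) (axis j 1)))" for v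
    by (subst linear_axis_expansion[OF l(2), of _ v]) (rule refl)
  finally have e: "f v v = (\<Sum>i\<in>UNIV. \<Sum>j\<in>UNIV. v $ i * v $ j * f (axis i 1) (axis j 1))" for v
    by (simp add: sum_distrib_left mult.assoc)
  have "(\<Sum>a\<in>UNIV. f (u a) (u a))
     = (\<Sum>i\<in>UNIV. \<Sum>a\<in>UNIV. \<Sum>j\<in>UNIV. u a $ i * u a $ j * f (axis i 1) (axis j 1))"
    unfolding e by (rule sum.swap)
  also have "\<dots> = (\<Sum>i\<in>UNIV. \<Sum>j\<in>UNIV. \<Sum>a\<in>UNIV. u a $ i * u a $ j * f (axis i 1) (axis j 1))"
    by (intro sum.cong refl sum.swap)
  finally show ?thesis by (simp add: c sum_distrib_right)
qed

context ccpsr_chart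
begin

lemma K_linear_right:
  assumes "x \<in> U"
  shows "K x v (w + w') = K x v w + K x v w'" "K x v (a *\<^sub>R w) = a *\<^sub>R K x v w"
  using K_linear[OF assms] by (simp_all only: K_sym[of x v])

lemma Q_linear:
  assumes "x \<in> U"
  shows "linear (\<lambda>a. Q x a b c d)" "linear (\<lambda>b. Q x a b c d)" "linear (\<lambda>c. Q x a b c d)" "linear (\<lambda>d. Q x a b c d)"
  by (intro linearI;
      simp add: Q_def M_linear[OF assms] K_linear[OF assms] K_linear_right[OF assms] algebra_simps)+

lemma Q_expansion:
  assumes "x \<in> U"
  shows "Q x a b c d = (\<Sum>m\<in>UNIV. d $ m * (\<Sum>i\<in>UNIV. \<Sum>j\<in>UNIV. \<Sum>k\<in>UNIV.
    Q x (axis i 1) (axis j 1) (axis k 1) (axis m 1) * a $ i * b $ j * c $ k))"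
proof -
  have "Q x a b c d = (\<Sum>m\<in>UNIV. d $ m *\<^sub>R Q x a b c (axis m 1))"
    by (rule linear_axis_expansion[OF Q_linear(4)[OF assms]])
  moreover have "Q x a b c (axis m 1) = (\<Sum>i\<in>UNIV. a $ i *\<^sub>R Q x (axis i 1) b c (axis m 1))" for m
    by (rule linear_axis_expansion[OF Q_linear(1)[OF assms]])
  moreover have "Q x (axis i 1) b c (axis m 1)
      = (\<Sum>j\<in>UNIV. b $ j *\<^sub>R Q x (axis i 1) (axis j 1) c (axis m 1))" for i m
    by (rule linear_axis_expansion[OF Q_linear(2)[OF assms]])
  moreover have "Q x (axis i 1) (axis j 1) c (axis m 1)
      = (\<Sum>k\<in>UNIV. c $ k *\<^sub>R Q x (axis i 1) (axis j 1) (axis k 1) (axis m 1))" for i j m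
    by (rule linear_axis_expansion[OF Q_linear(3)[OF assms]])
  ultimately have "Q x a b c d = (\<Sum>m\<in>UNIV. d $ m *\<^sub>R (\<Sum>i\<in>UNIV. a $ i *\<^sub>R (\<Sum>j\<in>UNIV. b $ j *\<^sub>R
      (\<Sum>k\<in>UNIV. c $ k *\<^sub>R Q x (axis i 1) (axis j 1) (axis k 1) (axis m 1)))))"
    by (simp only:)
  then show ?thesis by (simp add: sum_distrib_left mult_ac)
qed

lemma metric_inner_eq: "x \<in> U \<Longrightarrow> metric_inner g x v w = M x v w"
  by (simp add: metric_inner_def M_eq)

lemma metric_inner_curvature_operator:
  assumes "x \<in> U"
  shows "metric_inner g x (curvature_operator g x v w z) u = Q x v w z u"
proof -
  have "metric_inner g x (curvature_operator g x v w z) u = u \<bullet> (g x *v curvature_operator g x v w z)"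
    unfolding metric_inner_eq[OF assms] M_sym[of x _ u] by (rule M_eq[OF assms])
  moreover have "(g x *v curvature_operator g x v w z) $ m = (\<Sum>i\<in>UNIV. \<Sum>j\<in>UNIV. \<Sum>k\<in>UNIV.
    Q x (axis i 1) (axis j 1) (axis k 1) (axis m 1) * v $ i * w $ j * z $ k)" for m
  proof -
    have "(g x *v curvature_operator g x v w z) $ m
       = (\<Sum>l\<in>UNIV. \<Sum>i\<in>UNIV. \<Sum>j\<in>UNIV. \<Sum>k\<in>UNIV. g x $ m $ l * riemann g l k i j x * v $ i * w $ j * z $ k)"
      by (simp add: curvature_operator_def matrix_vector_mult_def sum_distrib_left mult.assoc)
    also have "\<dots> = (\<Sum>i\<in>UNIV. \<Sum>l\<in>UNIV. \<Sum>j\<in>UNIV. \<Sum>k\<in>UNIV. g x $ m $ l * riemann g l k i j x * v $ i * w $ j * z $ k)"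
      by (rule sum.swap)
    also have "\<dots> = (\<Sum>i\<in>UNIV. \<Sum>j\<in>UNIV. \<Sum>l\<in>UNIV. \<Sum>k\<in>UNIV. g x $ m $ l * riemann g l k i j x * v $ i * w $ j * z $ k)"
      by (intro sum.cong refl sum.swap)
    also have "\<dots> = (\<Sum>i\<in>UNIV. \<Sum>j\<in>UNIV. \<Sum>k\<in>UNIV. \<Sum>l\<in>UNIV. g x $ m $ l * riemann g l k i j x * v $ i * w $ j * z $ k)"
      by (intro sum.cong refl sum.swap)
    also have "\<dots> = (\<Sum>i\<in>UNIV. \<Sum>j\<in>UNIV. \<Sum>k\<in>UNIV.
      (\<Sum>l\<in>UNIV. g x $ m $ l * riemann g l k i j x) * v $ i * w $ j * z $ k)"
      by (simp only: sum_distrib_right)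
    finally show ?thesis unfolding lower_riemann_g[OF assms] .
  qed
  ultimately show ?thesis by (subst Q_expansion[OF assms]) (simp add: inner_vec_def)
qed

lemma riemann_eq:
  assumes "x \<in> U"
  shows "riemann g l k i j x = (\<Sum>m\<in>UNIV. matrix_inv (g x) $ l $ m * Q x (axis i 1) (axis j 1) (axis k 1) (axis m 1))"
proof -
  have "g x *v (\<chi> l. riemann g l k i j x) = (\<chi> m. Q x (axis i 1) (axis j 1) (axis k 1) (axis m 1))"
    by (simp add: vec_eq_iff matrix_vector_mult_def lower_riemann_g[OF assms])
  then have "matrix_inv (g x) *v (g x *v (\<chi> l. riemann g l k i j x))
      = matrix_inv (g x) *v (\<chi> m. Q x (axis i 1) (axis j 1) (axis k 1) (axis m 1))" by simp
  then have "(\<chi> l. riemann g l k i j x) = matrix_inv (g x) *v (\<chi> m. Q x (axis i 1) (axis j 1) (axis k 1) (axis m 1))"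
    by (simp add: matrix_vector_mul_assoc matrix_inv_inverse[OF invertible_g[OF assms]])
  then show ?thesis by (simp add: vec_eq_iff matrix_vector_mult_def)
qed

lemma scalar_curvature_eq:
  assumes x: "x \<in> U" and u: "\<And>a b. M x (u a) (u b) = (if a = b then 1 else 0)"
  shows "scalar_curvature g x = (\<Sum>a\<in>UNIV. \<Sum>b\<in>(UNIV::'n set). Q x (u b) (u a) (u a) (u b))"
proof -
  have inv: "matrix_inv (g x) $ i $ j = (\<Sum>a\<in>UNIV. u a $ i * u a $ j)" for i j
    using u unfolding M_eq[OF x] by (rule matrix_inv_orthonormal)
  have ric: "ricci g j k x = (\<Sum>b\<in>UNIV. Q x (u b) (axis j 1) (axis k 1) (u b))" for j k
    unfolding ricci_def riemann_eq[OF x]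
    by (rule bilinear_trace[OF _ inv]) (simp add: bilinear_def Q_linear[OF x])
  show ?thesis
    unfolding scalar_curvature_def ric
    by (rule bilinear_trace[OF _ inv]) (simp add: bilinear_def Q_linear[OF x] linear_compose_sum)
qed

lemma M_nonneg: "x \<in> U \<Longrightarrow> M x v v \<ge> 0"
  using M_pos[of x v] M_linear(3)[of x 0 0 v] by (cases "v = 0") simp_all

lemma trilinear_bound:
  assumes "x \<in> U"
  shows "\<bar>T (L x u) (L x v) (L x w)\<bar> \<le> 4 * sqrt (M x u u) * sqrt (M x v v) * sqrt (M x w w)"
  using ccpsr_trilinear_bound[OF ccpsr phi_in_H[OF assms] T_phi_L[OF assms] T_phi_L[OF assms] T_phi_L[OF assms]]
  unfolding M_def .

lemma norm_K_le:
  assumes "x \<in> U"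
  shows "sqrt (M x (K x v w) (K x v w)) \<le> 4 * sqrt (M x v v) * sqrt (M x w w)"
proof -
  let ?k = "sqrt (M x (K x v w) (K x v w))"
  have "?k * ?k = M x (K x v w) (K x v w)" using M_nonneg[OF assms] by simp
  also have "\<dots> \<le> \<bar>T (L x v) (L x w) (L x (K x v w))\<bar>" unfolding M_K[OF assms] by simp
  also have "\<dots> \<le> (4 * sqrt (M x v v) * sqrt (M x w w)) * ?k" by (rule trilinear_bound[OF assms])
  finally have *: "?k * ?k \<le> (4 * sqrt (M x v v) * sqrt (M x w w)) * ?k" .
  show ?thesis
  proof (cases "?k = 0")
    case True
    then show ?thesis using M_nonneg[OF assms] by simp
  next
    case False
    then have "?k > 0" using M_nonneg[OF assms] by (simp add: less_le)
    then show ?thesis using * by (simp only: mult_le_cancel_right_pos)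
  qed
qed

lemma M_gram_shear:
  assumes "x \<in> U" and s: "s * M x v v = - M x v w"
  shows "M x v v * M x (w + s *\<^sub>R v) (w + s *\<^sub>R v) = M x v v * M x w w - (M x v w)\<^sup>2"
proof -
  have "M x (w + s *\<^sub>R v) (w + s *\<^sub>R v) = M x w w + s * M x v w + s * (M x v w + s * M x v v)"
    using M_sym[of x w v] by (simp add: M_linear[OF assms(1)] algebra_simps)
  also have "\<dots> = M x w w + s * M x v w" by (simp add: s)
  finally have "M x v v * M x (w + s *\<^sub>R v) (w + s *\<^sub>R v) = M x v v * M x w w + (s * M x v v) * M x v w"
    by (simp add: algebra_simps)
  then show ?thesis unfolding s by (simp add: power2_eq_square)
qed

lemma M_cauchy_schwarz:
  assumes "x \<in> U"
  shows "(M x v w)\<^sup>2 \<le> M x v v * M x w w"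
proof (cases "v = 0")
  case True
  then show ?thesis using M_linear(3)[OF assms, of 0 0] by simp
next
  case False
  then have p: "M x v v > 0" using M_pos[OF assms] by blast
  define s where "s = - M x v w / M x v v"
  have "s * M x v v = - M x v w" using p by (simp add: s_def)
  from M_gram_shear[OF assms this]
  have "M x v v * M x w w - (M x v w)\<^sup>2 = M x v v * M x (w + s *\<^sub>R v) (w + s *\<^sub>R v)" ..
  also have "\<dots> \<ge> 0" by (intro mult_nonneg_nonneg M_nonneg assms)
  finally show ?thesis by simp
qed

lemma Q_bound:
  assumes "x \<in> U"
  shows "\<bar>Q x v w w v\<bar> \<le> 33 * (M x v v * M x w w)"
proof -
  note nn = M_nonneg[OF assms]
  have sq: "4 * sqrt a * sqrt a * (4 * sqrt b * sqrt b) = 16 * (a * b)" if "a \<ge> 0" "b \<ge> 0" for a b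
  proof -
    have "4 * sqrt a * sqrt a * (4 * sqrt b * sqrt b) = 16 * ((sqrt a * sqrt a) * (sqrt b * sqrt b))"
      by simp
    then show ?thesis using that by simp
  qed
  have "sqrt (M x (K x v w) (K x v w)) ^ 2 \<le> (4 * sqrt (M x v v) * sqrt (M x w w)) ^ 2"
    by (intro power_mono norm_K_le assms) (simp add: nn)
  then have 1: "M x (K x v w) (K x v w) \<le> 16 * (M x v v * M x w w)"
    by (simp add: power_mult_distrib nn)
  have "\<bar>M x (K x w w) (K x v v)\<bar> \<le> (4 * sqrt (M x v v) * sqrt (M x v v)) * sqrt (M x (K x w w) (K x w w))"
    using trilinear_bound[OF assms, of v v "K x w w"]
    by (simp only: M_K[OF assms, of "K x w w" v v] abs_minus_cancel)
  also have "\<dots> \<le> (4 * sqrt (M x v v) * sqrt (M x v v)) * (4 * sqrt (M x w w) * sqrt (M x w w))"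
    by (intro mult_left_mono norm_K_le assms) (simp add: nn)
  finally have 2: "\<bar>M x (K x w w) (K x v v)\<bar> \<le> 16 * (M x v v * M x w w)"
    by (simp only: sq[OF nn nn])
  have "Q x v w w v = (M x v w)\<^sup>2 - M x v v * M x w w + M x (K x v w) (K x v w) - M x (K x w w) (K x v v)"
    unfolding Q_def using M_sym[of x w v] K_sym[of x w v] by (simp add: power2_eq_square)
  moreover have "0 \<le> M x v v * M x w w" using nn by simp
  ultimately show ?thesis
    using 1 2 M_cauchy_schwarz[OF assms, of v w] nn[of "K x v w"] zero_le_power2[of "M x v w"]
    unfolding abs_le_iff by linarith
qed

lemma scalar_curvature_bound:
  assumes x: "x \<in> U"
  shows "\<bar>scalar_curvature g x\<bar> \<le> 33 * (real CARD('n))\<^sup>2"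
proof -
  have "bilinear (M x)"
    unfolding bilinear_def using M_linear[OF x] by (auto intro!: linearI)
  then have "\<exists>u :: 'n \<Rightarrow> _. \<forall>a b. M x (u a) (u b) = (if a = b then 1 else 0)"
    by (rule orthonormal_family_exists[OF _ M_sym M_pos[OF x]])
  then obtain u :: "'n \<Rightarrow> real ^ 'n" where u: "\<And>a b. M x (u a) (u b) = (if a = b then 1 else 0)" by blast
  have "\<bar>scalar_curvature g x\<bar> \<le> (\<Sum>a\<in>UNIV. \<bar>\<Sum>b\<in>(UNIV::'n set). Q x (u b) (u a) (u a) (u b)\<bar>)"
    unfolding scalar_curvature_eq[where u=u, OF x u] by (rule sum_abs)
  also have "\<dots> \<le> (\<Sum>a\<in>(UNIV::'n set). \<Sum>b\<in>(UNIV::'n set). \<bar>Q x (u b) (u a) (u a) (u b)\<bar>)"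
    by (intro sum_mono sum_abs)
  also have "\<dots> \<le> (\<Sum>a\<in>(UNIV::'n set). \<Sum>b\<in>(UNIV::'n set). 33)"
    using Q_bound[OF x] u by (intro sum_mono) (metis mult.right_neutral)
  finally show ?thesis by (simp add: power2_eq_square)
qed

lemma Q_shear:
  assumes "x \<in> U"
  shows "Q x v (w + s *\<^sub>R v) (w + s *\<^sub>R v) v = Q x v w w v"
proof -
  have "Q x v v c d = 0" "Q x a b v v = 0" for a b c d
    unfolding Q_def using M_sym[of x "K x a v"] by (simp_all add: mult.commute)
  then show ?thesis
    by (simp add: linear_add[OF Q_linear(2)[OF assms]] linear_add[OF Q_linear(3)[OF assms]]
        linear_cmul[OF Q_linear(2)[OF assms]] linear_cmul[OF Q_linear(3)[OF assms]])
qed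

lemma sectional_curvature_bound:
  assumes x: "x \<in> U" and ind: "v \<noteq> w" "independent {v, w}"
  shows "\<bar>sectional_curvature g x v w\<bar> \<le> 33"
proof -
  have "v \<noteq> 0" using ind(2) dependent_zero by blast
  then have p: "M x v v > 0" using M_pos[OF x] by blast
  define s where "s = - M x v w / M x v v"
  define w' where "w' = w + s *\<^sub>R v"
  have "w' \<noteq> 0"
  proof
    assume "w' = 0"
    then have "w = (- s) *\<^sub>R v" by (simp add: w'_def eq_neg_iff_add_eq_0)
    moreover have "(- s) *\<^sub>R v \<in> span {v}" by (intro span_scale span_base) simp
    ultimately have "w \<in> span {v}" by (simp only:)
    then show False using ind by (metis independent_insert insert_commute insertI1 singletonD)
  qed
  then have p': "M x w' w' > 0" using M_pos[OF x] by blast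
  have "M x v v * M x w w - (M x v w)\<^sup>2 = M x v v * M x w' w'"
    unfolding w'_def by (rule M_gram_shear[OF x, symmetric]) (use p in \<open>simp add: s_def\<close>)
  then have sec: "sectional_curvature g x v w = Q x v w' w' v / (M x v v * M x w' w')"
    unfolding sectional_curvature_def metric_inner_curvature_operator[OF x] w'_def Q_shear[OF x]
    by (simp add: metric_inner_eq[OF x])
  have D: "M x v v * M x w' w' > 0" using p p' by simp
  show ?thesis
    unfolding sec abs_divide abs_of_pos[OF D] pos_divide_le_eq[OF D] by (rule Q_bound[OF x])
qed

end

theorem corollary5p1:
  assumes "CARD('m::finite) = CARD('n::finite) + 1"
    and "CARD('n) \<ge> 2"
  shows "\<exists>l u l' u' :: real.
    \<forall>(h :: real ^ 'm \<Rightarrow> real) (H :: (real ^ 'm) set). ccpsr_manifold h H \<longrightarrow>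
      (\<forall>(U :: (real ^ 'n) set) (\<phi> :: real ^ 'n \<Rightarrow> real ^ 'm) x.
         local_parametrization H U \<phi> \<longrightarrow> x \<in> U \<longrightarrow>
           l \<le> scalar_curvature (metric_coords h \<phi>) x \<and>
           scalar_curvature (metric_coords h \<phi>) x \<le> u \<and>
           (\<forall>v w. v \<noteq> w \<and> independent {v, w} \<longrightarrow>
              l' \<le> sectional_curvature (metric_coords h \<phi>) x v w \<and>
              sectional_curvature (metric_coords h \<phi>) x v w \<le> u'))"
proof -
  let ?c = "33 * (real CARD('n))\<^sup>2"
  have bounds: "- ?c \<le> scalar_curvature (metric_coords h \<phi>) x \<and> scalar_curvature (metric_coords h \<phi>) x \<le> ?c \<and>
      (\<forall>v w. v \<noteq> w \<and> independent {v, w} \<longrightarrow>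
         - 33 \<le> sectional_curvature (metric_coords h \<phi>) x v w \<and>
         sectional_curvature (metric_coords h \<phi>) x v w \<le> 33)"
    if "ccpsr_manifold h H" "local_parametrization H U \<phi>" "x \<in> U"
    for h :: "real ^ 'm \<Rightarrow> real" and H and U :: "(real ^ 'n) set" and \<phi> x
  proof -
    obtain t where "cubic_form h t"
      using homogeneous_cubic_polarisation \<open>ccpsr_manifold h H\<close> unfolding ccpsr_manifold_def by blast
    then interpret ccpsr_chart h t H U \<phi>
      using that assms(1) by (simp add: ccpsr_chart_def ccpsr_chart_axioms_def)
    have "- 33 \<le> sectional_curvature g x v w \<and> sectional_curvature g x v w \<le> 33"
      if "v \<noteq> w" "independent {v, w}" for v w
      using sectional_curvature_bound[OF \<open>x \<in> U\<close> that] by linarith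
    moreover have "- ?c \<le> scalar_curvature g x \<and> scalar_curvature g x \<le> ?c"
      using scalar_curvature_bound[OF \<open>x \<in> U\<close>] by linarith
    ultimately show ?thesis by blast
  qed
  show ?thesis
    by (rule exI[of _ "- ?c"], rule exI[of _ ?c], rule exI[of _ "- 33"], rule exI[of _ 33])
      (intro allI impI, rule bounds)
qed

end
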